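(* Let $\alpha>0$, let $\phi$ be a positive function which varies smoothly (hence regularly) at $\infty$, and assume that $\Lambda(v)=v^{-\alpha}\phi(\log v)$ is strictly decreasing. Consider on the infinite symmetric group $S_\infty$ the homogeneous hierarchical Laplacian with eigenvalues $\lambda_k=\Lambda(V(k))$, where $V(k)=(k+1)!$, respectively the associated isotropic random walk, and let $\mathfrak{p}(t)$ be its on-diagonal heat kernel (return probability). For sufficiently large $t$ set $$\rho(t)=\frac{\log t}{\alpha\log\log t},\qquad \psi(t)=t^{-1/\alpha}\left(\frac{\log\rho(t)}{\phi\bigl(\rho(t)\log\rho(t)\bigr)}\right)^{1/\alpha},\qquad \Psi(t)=t^{-1/\alpha}\left(\frac{\rho(t)^\alpha}{e\,\alpha\,\phi\bigl(\rho(t)\log\rho(t)\bigr)}\right)^{1/\alpha}.$$ Then $$\limsup\frac{\mathfrak{p}(t)}{\Psi(t)}=1\qquad\text{and}\qquad\liminf\frac{\mathfrak{p}(t)}{\psi(t)}=1,$$ both as $t\to\infty$ through $\mathbb{R}$ and as $t\to\infty$ through $\mathbb{N}$.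
   Context: $S_\infty$ is the group of all permutations of $\mathbb{N}=\{1,2,\dots\}$ fixing all but finitely many elements. $S_j$ is the subgroup of those permutations which fix every $n>j$, and $\mathfrak{G}_k:=S_{k+1}$, $k\ge0$ (so $\mathfrak{G}_0=\{e\}$). The balls of level $k$ are the left cosets of $S_{k+1}$; each ball of level $k\ge1$ consists of $n_k=k+1$ balls of level $k-1$. The reference measure $m$ is the counting measure, so a ball of level $k$ has volume $V(k)=(k+1)!$. With $\lambda_k=\Lambda(V(k))$ and $C_k=\lambda_k-\lambda_{k+1}$, the hierarchical Laplacian acts on finitely supported functions $f$ by $Lf(x)=\sum_{k\ge1}C_k\bigl(f(x)-\frac1{V(k)}\sum_{y\in x\mathfrak{G}_k}f(y)\bigr)$. It is essentially self-adjoint in $\ell^2(S_\infty)$, and $L$ also denotes its self-adjoint extension. The function $\mathfrak{p}(t)=\mathfrak{p}(t,x,x)$, $t>0$, is the diagonal value of the kernel of $e^{-tL}$ with respect to $m$. It is independent of $x$ and is given by $$\mathfrak{p}(t)=\sum_{k\ge1}e^{-t\lambda_k}\Bigl(\frac1{V(k-1)}-\frac1{V(k)}\Bigr).$$ The associated random walk is the random walk on $S_\infty$ driven by the probability measure $\mu=\sum_{k\ge0}\pi_k\,\mathrm{unif}(\mathfrak{G}_k)$, where $\mathrm{unif}(\mathfrak{G}_k)$ is the uniform distribution on $\mathfrak{G}_k$, $\pi_0=e^{-\lambda_1}$ and $\pi_k=e^{-\lambda_{k+1}}-e^{-\lambda_k}$ for $k\ge1$. For $n\in\mathbb{N}$,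 $\mathfrak{p}(n)=\mu^{(n)}(e)$ is its $n$-step return probability ($\mu^{(n)}$ being the $n$-th convolution power). A positive function $\phi$ varies regularly at $\infty$ with index $\kappa\in\mathbb{R}$ if $\phi(cx)/\phi(x)\to c^{\kappa}$ as $x\to\infty$ for every $c>0$. It varies smoothly with index $\kappa$ if it is $C^\infty$ in a neighbourhood of $\infty$ and $h(x)=\log\phi(e^x)$ satisfies $h'(x)\to\kappa$ and $h^{(n)}(x)\to0$ for all $n\ge2$ as $x\to\infty$. The index of $\phi$ is an arbitrary real number. $\log$ is the natural logarithm. *)

theory Defs
  imports "HOL-Probability.Probability" "HOL-Combinatorics.Perm"
begin

text \<open>
  The type \<^typ>\<open>nat perm\<close> of finitely supported permutations of \<open>{0, 1, 2, \<dots>}\<close>, with composition as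
  multiplication, is the infinite symmetric group; points are numbered from 0 instead of from 1, so
  \<open>Sym j\<close> permutes the first \<open>j\<close> points \<open>{0, \<dots>, j - 1}\<close>.
\<close>

definition Sym :: "nat \<Rightarrow> nat perm set" where
  "Sym j = {g. \<forall>i\<ge>j. Perm.apply g i = i}"

definition GG :: "nat \<Rightarrow> nat perm set" where
  "GG k = Sym (k + 1)"

definition level_ball :: "nat perm \<Rightarrow> nat \<Rightarrow> nat perm set" where
  "level_ball x k = (\<lambda>g. x * g) ` GG k"

definition V :: "nat \<Rightarrow> real" where
  "V k = fact (k + 1)"

definition eigenval :: "(real \<Rightarrow> real) \<Rightarrow> nat \<Rightarrow> real" where
  "eigenval Lam k = Lam (V k)"

definition lap_coeff :: "(real \<Rightarrow> real) \<Rightarrow> nat \<Rightarrow> real" where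
  "lap_coeff Lam k = eigenval Lam k - eigenval Lam (k + 1)"

text \<open>
  The formula for the Laplacian. The operator of interest has the finitely supported functions as
  its domain; the sum over the levels \<open>k \<ge> 1\<close> is shifted by one.
\<close>

definition laplacian :: "(real \<Rightarrow> real) \<Rightarrow> (nat perm \<Rightarrow> real) \<Rightarrow> nat perm \<Rightarrow> real" where
  "laplacian Lam f x =
     (\<Sum>k. lap_coeff Lam (Suc k) *
            (f x - (1 / V (Suc k)) * (\<Sum>y\<in>level_ball x (Suc k). f y)))"

text \<open>The Hilbert space over the group with counting measure.\<close>

definition ell2 :: "('a \<Rightarrow> real) set" where
  "ell2 = {f. (\<lambda>x. (f x)\<^sup>2) summable_on UNIV}"

definition ell2_norm :: "('a \<Rightarrow> real) \<Rightarrow> real" where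
  "ell2_norm f = sqrt (\<Sum>\<^sub>\<infinity>x. (f x)\<^sup>2)"

definition ell2_tendsto :: "(nat \<Rightarrow> 'a \<Rightarrow> real) \<Rightarrow> ('a \<Rightarrow> real) \<Rightarrow> bool" where
  "ell2_tendsto F f \<longleftrightarrow>
     (\<forall>n. F n \<in> ell2) \<and> f \<in> ell2 \<and> (\<lambda>n. ell2_norm (\<lambda>x. F n x - f x)) \<longlonglongrightarrow> 0"

text \<open>
  The self-adjoint extension of an essentially self-adjoint operator is its closure: the graph of
  \<open>laplacian_ext\<close> is the closure of the graph of \<open>laplacian\<close> on the finitely supported functions.
\<close>

definition laplacian_ext :: "(real \<Rightarrow> real) \<Rightarrow> (nat perm \<Rightarrow> real) \<Rightarrow> nat perm \<Rightarrow> real" where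
  "laplacian_ext Lam f =
     (THE g. \<exists>F. (\<forall>n. finite {x. F n x \<noteq> 0}) \<and> ell2_tendsto F f \<and>
                 ell2_tendsto (\<lambda>n. laplacian Lam (F n)) g)"

text \<open>
  When \<open>Lam\<close> decreases to 0 along the volumes, the coefficients are positive with finite sum
  \<open>eigenval Lam 1\<close>. As \<open>laplacian\<close> combines the differences of the identity and the averaging
  projections with these coefficients, its closure is a bounded self-adjoint operator, defined on all
  of \<open>ell2\<close>. Hence its heat semigroup is given by the exponential series.
\<close>

definition heat_semigroup ::
    "(real \<Rightarrow> real) \<Rightarrow> real \<Rightarrow> (nat perm \<Rightarrow> real) \<Rightarrow> nat perm \<Rightarrow> real" where
  "heat_semigroup Lam t f =
     (THE u. ell2_tendsto
        (\<lambda>N x. \<Sum>n<N. (- t) ^ n / fact n * (laplacian_ext Lam ^^ n) f x) u)"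

definition heat_kernel ::
    "(real \<Rightarrow> real) \<Rightarrow> real \<Rightarrow> nat perm \<Rightarrow> nat perm \<Rightarrow> real" where
  "heat_kernel Lam t x y = heat_semigroup Lam t (indicator {y}) x"

definition level_weight :: "(real \<Rightarrow> real) \<Rightarrow> nat \<Rightarrow> real" where
  "level_weight Lam k =
     (if k = 0 then exp (- eigenval Lam 1)
      else exp (- eigenval Lam (k + 1)) - exp (- eigenval Lam k))"

text \<open>
  The step distribution is the mixture of the uniform distributions on the groups \<open>GG k\<close>. The
  weights form a probability distribution when \<open>Lam\<close> decreases to 0 along the volumes;
  \<^const>\<open>embed_pmf\<close> is meaningful only then.
\<close>

definition step_pmf :: "(real \<Rightarrow> real) \<Rightarrow> nat perm pmf" where
  "step_pmf Lam = bind_pmf (embed_pmf (level_weight Lam)) (\<lambda>k. pmf_of_set (GG k))"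

fun conv_power :: "nat perm pmf \<Rightarrow> nat \<Rightarrow> nat perm pmf" where
  "conv_power \<mu> 0 = return_pmf 1"
| "conv_power \<mu> (Suc n) =
     bind_pmf \<mu> (\<lambda>g. map_pmf (\<lambda>h. g * h) (conv_power \<mu> n))"

definition return_prob :: "(real \<Rightarrow> real) \<Rightarrow> nat \<Rightarrow> real" where
  "return_prob Lam n = pmf (conv_power (step_pmf Lam) n) 1"

definition smoothly_varying :: "(real \<Rightarrow> real) \<Rightarrow> real \<Rightarrow> bool" where
  "smoothly_varying \<phi> \<kappa> \<longleftrightarrow>
     (\<exists>a. \<forall>x>a. \<forall>n. (deriv ^^ n) \<phi> differentiable (at x)) \<and>
     (let h = (\<lambda>x. ln (\<phi> (exp x))) in
        (deriv h \<longlongrightarrow> \<kappa>) at_top \<and>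
        (\<forall>n\<ge>2. ((deriv ^^ n) h \<longlongrightarrow> 0) at_top))"

definition Lambda :: "real \<Rightarrow> (real \<Rightarrow> real) \<Rightarrow> real \<Rightarrow> real" where
  "Lambda \<alpha> \<phi> v = v powr (- \<alpha>) * \<phi> (ln v)"

definition \<rho> :: "real \<Rightarrow> real \<Rightarrow> real" where
  "\<rho> \<alpha> t = ln t / (\<alpha> * ln (ln t))"

definition \<psi> :: "real \<Rightarrow> (real \<Rightarrow> real) \<Rightarrow> real \<Rightarrow> real" where
  "\<psi> \<alpha> \<phi> t =
     t powr (- 1 / \<alpha>) * (ln (\<rho> \<alpha> t) / \<phi> (\<rho> \<alpha> t * ln (\<rho> \<alpha> t))) powr (1 / \<alpha>)"

definition \<Psi> :: "real \<Rightarrow> (real \<Rightarrow> real) \<Rightarrow> real \<Rightarrow> real" where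
  "\<Psi> \<alpha> \<phi> t =
     t powr (- 1 / \<alpha>) *
       (\<rho> \<alpha> t powr \<alpha> / (exp 1 * \<alpha> * \<phi> (\<rho> \<alpha> t * ln (\<rho> \<alpha> t)))) powr (1 / \<alpha>)"

end

theory Submission
  imports Defs "HOL-Real_Asymp.Real_Asymp"
begin

text \<open>
  All averaging operators over the groups \<^const>\<open>GG\<close> \<open>k\<close> are simultaneously diagonal: averaging over
  \<open>GG i\<close> and then over \<open>GG k\<close> is averaging over the larger of the two. The point mass at the identity
  is the sum of its components \<open>layer k\<close> in the common eigenspaces, and on the \<open>k\<close>-th of them the
  Laplacian is the scalar \<open>\<lambda>(k + 1)\<close>, while convolution with the step distribution is the scalar
  \<open>exp (- \<lambda>(k + 1))\<close> (lemmas \<open>laplacian_synth\<close> and \<open>pmf_conv_power\<close>). Both the heat kernel on the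
  diagonal and the return probability are therefore values of one function,
  \<open>p t = (\<Sum>k\<ge>1. exp (- t * \<lambda> k) * (k / V k))\<close>, and only its behaviour at infinity is left to study.

  Consecutive eigenvalues differ by a factor of order \<open>k powr \<alpha>\<close>, which tends to infinity. So
  for a given \<open>t\<close> at most one of the numbers \<open>t * \<lambda> k\<close> is of moderate size: the terms before this level
  are killed by their exponentials, and the exponentials after it are close to 1, so that those terms
  add up to about \<open>1 / V k\<close>. Put \<open>x = t * \<lambda> k\<close> and \<open>b k = \<phi> (ln (V k)) powr (- 1 / \<alpha>)\<close>. Since
  \<open>t powr (1 / \<alpha>) / V k = x powr (1 / \<alpha>) * b k\<close>, the rescaled kernel \<open>t powr (1 / \<alpha>) * p t\<close> is close to
  \<open>x powr (1 / \<alpha>) * exp (- x) * k * b k + x powr (1 / \<alpha>) * b k\<close>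
  (lemmas \<open>diag_kernel_lower\<close> and \<open>diag_kernel_upper\<close>). The first summand has its peak at \<open>x = 1 / \<alpha>\<close>,
  with a value proportional to \<open>k * b k\<close>; these peaks produce the upper limit. The lower limit comes from
  the valleys between two peaks: at \<open>x\<close> about \<open>ln k\<close> the exponential has just compensated the factor \<open>k\<close>,
  and what remains is about \<open>(ln k) powr (1 / \<alpha>) * b k\<close>.

  The functions \<open>\<Psi>\<close> and \<open>\<psi>\<close> express these two values in terms of \<open>t\<close> instead of \<open>k\<close>. Everywhere in this
  range of \<open>t\<close>, \<open>ln t\<close> is asymptotic to \<open>\<alpha> * ln (V k)\<close> and hence to \<open>\<alpha> * k * ln k\<close>, because \<open>ln (\<phi> s)\<close> is
  negligible compared with \<open>s\<close>; so \<open>\<rho> t\<close> is asymptotic to \<open>k\<close> and \<open>\<rho> t * ln (\<rho> t)\<close> to \<open>ln (V k)\<close>, and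
  regular variation allows one to replace the argument of \<open>\<phi>\<close> by an asymptotically equal one
  (lemma \<open>normalisation\<close>). For the peaks and the valleys the time can be chosen to be an integer, as \<open>\<lambda> k\<close>
  tends to 0; this is why the limits along the reals and along the integers coincide.
\<close>

section \<open>Uniform densities on the finite symmetric groups\<close>

lemma one_mem_GG [simp]: "1 \<in> GG k"
  by (simp add: GG_def Sym_def)

lemma mult_mem_GG: "g \<in> GG k \<Longrightarrow> h \<in> GG k \<Longrightarrow> g * h \<in> GG k"
  by (simp add: GG_def Sym_def apply_times)

lemma inverse_mem_GG:
  assumes "g \<in> GG k" shows "inverse g \<in> GG k"
proof -
  have "Perm.apply (inverse g) i = i" if "i \<ge> k + 1" for i
    using assms that
    by (simp add: GG_def Sym_def apply_inverse) (metis bij_apply bij_inv_eq_iff)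
  thus ?thesis by (simp add: GG_def Sym_def)
qed

lemma inverse_mem_GG_iff [simp]: "inverse g \<in> GG k \<longleftrightarrow> g \<in> GG k"
  using inverse_mem_GG perm.inverse_inverse by metis

lemma mult_right_mem_GG_iff:
  assumes "g \<in> GG k" shows "z * g \<in> GG k \<longleftrightarrow> z \<in> GG k"
proof
  assume "z * g \<in> GG k"
  hence "z * g * inverse g \<in> GG k" using mult_mem_GG inverse_mem_GG[OF assms] by blast
  moreover have "z * g * inverse g = z" by (simp only: mult.assoc perm.right_inverse mult_1_right)
  ultimately show "z \<in> GG k" by simp
qed (use assms in \<open>auto intro: mult_mem_GG\<close>)

lemma GG_mono: "i \<le> k \<Longrightarrow> GG i \<subseteq> GG k"
  by (auto simp: GG_def Sym_def)

text \<open>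
  The finite groups are the usual permutation groups; this identification gives their cardinality.
\<close>

lemma bij_betw_apply_GG: "bij_betw Perm.apply (GG k) {p. p permutes {..<k + 1}}"
proof (rule bij_betwI')
  fix g h :: "nat perm"
  show "(Perm.apply g = Perm.apply h) = (g = h)" by (simp add: apply_inject)
next
  fix g assume "g \<in> GG k"
  thus "Perm.apply g \<in> {p. p permutes {..<k + 1}}"
    by (auto simp: GG_def Sym_def permutes_def simp flip: bij_iff)
next
  fix p assume "p \<in> {p. p permutes {..<k + 1}}"
  hence p: "p permutes {..<k + 1}" by simp
  have "{a. p a \<noteq> a} \<subseteq> {..<k + 1}" using p by (auto simp: permutes_def)
  hence "Perm.apply (Perm p) = p"
    using p by (intro Perm_inverse) (auto simp: permutes_bij intro: finite_subset)
  moreover have "\<forall>i\<ge>k + 1. p i = i" using p by (auto simp: permutes_def)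
  ultimately show "\<exists>g\<in>GG k. p = Perm.apply g"
    by (intro bexI[of _ "Perm p"]) (auto simp: GG_def Sym_def)
qed

lemma finite_GG [simp]: "finite (GG k)"
  using bij_betw_finite[OF bij_betw_apply_GG] finite_permutations[of "{..<k + 1}"] by simp

lemma card_GG: "real (card (GG k)) = V k"
  using bij_betw_same_card[OF bij_betw_apply_GG, of k] card_permutations[of "{..<k + 1}" "k + 1"]
  by (simp add: V_def algebra_simps)

lemma GG_0: "GG 0 = {1}"
proof -
  have "card (GG 0) = 1" using card_GG[of 0] by (simp add: V_def)
  then obtain g where "GG 0 = {g}" by (auto simp: card_1_singleton_iff)
  with one_mem_GG[of 0] show ?thesis by auto
qed

lemma GG_exhaust: "\<exists>k. g \<in> GG k"
proof -
  obtain k where "affected g \<subseteq> {..<k}"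
    using finite_affected[of g] unfolding finite_nat_iff_bounded by blast
  hence "Perm.apply g i = i" if "i \<ge> k + 1" for i
    using that by (auto simp: subset_iff in_affected)
  thus ?thesis by (auto simp: GG_def Sym_def)
qed

lemma V_pos [simp]: "V k > 0"
  by (simp add: V_def)

lemma V_ne_0 [simp]: "V k \<noteq> 0"
  by (simp add: V_def)

lemma V_nonneg [simp]: "V k \<ge> 0"
  by (simp add: V_def)

lemma V_Suc: "V (Suc k) = (real k + 2) * V k"
  by (simp add: V_def algebra_simps)

lemma V_growth: "2 ^ n * V k \<le> V (k + n)"
proof (induction n)
  case (Suc n)
  have "2 ^ Suc n * V k \<le> 2 * V (k + n)" using Suc by simp
  also have "\<dots> \<le> V (k + Suc n)" by (simp add: V_Suc)
  finally show ?case .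
qed simp

lemma inverse_V_add_le: "1 / V (k + n) \<le> (1 / V k) * (1 / 2) ^ n"
  using V_growth[of n k] by (simp add: field_simps)

lemma summable_inverse_V: "summable (\<lambda>k. 1 / V k)"
proof (rule summable_comparison_test)
  show "\<exists>N. \<forall>n\<ge>N. norm (1 / V n) \<le> (1 / 2) ^ n"
    using inverse_V_add_le[of 0] by (auto simp: V_def)
qed simp

lemma inverse_V_tendsto_0: "(\<lambda>k. 1 / V k) \<longlonglongrightarrow> 0"
  using summable_LIMSEQ_zero[OF summable_inverse_V] .

definition unif_density :: "nat \<Rightarrow> nat perm \<Rightarrow> real" where
  "unif_density k z = indicator (GG k) z / V k"

lemma unif_density_nonneg [simp]: "unif_density k z \<ge> 0"
  by (simp add: unif_density_def)

lemma unif_density_le: "unif_density k z \<le> 1 / V k"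
  by (auto simp: unif_density_def indicator_def divide_right_mono)

lemma unif_density_inverse: "unif_density k (inverse z) = unif_density k z"
  by (simp add: unif_density_def indicator_def)

text \<open>
  The cosets of \<open>GG i\<close> and \<open>GG k\<close> are nested. If \<open>i \<le> k\<close>, the density is constant on the cosets over which
  it is averaged; if \<open>i > k\<close>, its whole mass lies in one coset and gets spread evenly over it.
\<close>

lemma average_unif_density:
  "(1 / V i) * (\<Sum>g\<in>GG i. unif_density k (z * g)) = unif_density (max i k) z"
proof (cases "i \<le> k")
  case True
  hence "unif_density k (z * g) = unif_density k z" if "g \<in> GG i" for g
    using mult_right_mem_GG_iff[of g k z] GG_mono[OF True] that
    by (auto simp: unif_density_def indicator_def)
  hence "(\<Sum>g\<in>GG i. unif_density k (z * g)) = V i * unif_density k z"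
    by (simp add: card_GG)
  thus ?thesis using True by (simp add: max_absorb2)
next
  case False
  hence sub: "GG k \<subseteq> GG i" by (intro GG_mono) simp
  show ?thesis
  proof (cases "z \<in> GG i")
    case True
    have bij: "bij_betw (\<lambda>g. z * g) (GG i) (GG i)"
    proof (rule bij_betw_byWitness[where f' = "\<lambda>g. inverse z * g"])
      show "\<forall>a\<in>GG i. inverse z * (z * a) = a" "\<forall>a'\<in>GG i. z * (inverse z * a') = a'"
        by (simp_all flip: mult.assoc)
    qed (use True in \<open>auto intro: mult_mem_GG inverse_mem_GG\<close>)
    have "(\<Sum>g\<in>GG i. unif_density k (z * g)) = (\<Sum>g\<in>GG i. unif_density k g)"
      by (rule sum.reindex_bij_betw[OF bij])
    also have "\<dots> = (\<Sum>g\<in>GG k. unif_density k g)"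
      using sub by (intro sum.mono_neutral_right) (auto simp: unif_density_def)
    also have "\<dots> = 1" by (simp add: unif_density_def card_GG flip: sum_divide_distrib)
    finally show ?thesis using True False by (simp add: unif_density_def)
  next
    case notin: False
    have "unif_density k (z * g) = 0" if "g \<in> GG i" for g
      using notin that sub mult_right_mem_GG_iff[of g i z] by (auto simp: unif_density_def indicator_def)
    thus ?thesis using notin False by (simp add: unif_density_def)
  qed
qed

section \<open>Functions synthesised from the eigenspaces\<close>

text \<open>
  The component of the point mass at the identity in the \<open>k\<close>-th of the eigenspaces shared by all the
  averaging operators.
\<close>

definition layer :: "nat \<Rightarrow> nat perm \<Rightarrow> real" where
  "layer k z = unif_density k z - unif_density (Suc k) z"

lemma average_layer:
  "(1 / V i) * (\<Sum>g\<in>GG i. layer k (z * g)) = (if i \<le> k then layer k z else 0)"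
proof -
  have "(1 / V i) * (\<Sum>g\<in>GG i. layer k (z * g)) =
        (1 / V i) * (\<Sum>g\<in>GG i. unif_density k (z * g)) -
        (1 / V i) * (\<Sum>g\<in>GG i. unif_density (Suc k) (z * g))"
    by (simp add: layer_def sum_subtractf diff_divide_distrib)
  thus ?thesis unfolding average_unif_density by (auto simp: layer_def max_def le_Suc_eq)
qed

lemma abs_layer_le: "\<bar>layer k z\<bar> \<le> unif_density k z + unif_density (Suc k) z"
  unfolding layer_def using unif_density_nonneg[of k z] unif_density_nonneg[of "Suc k" z] by linarith

lemma abs_layer_le_V: "\<bar>layer k z\<bar> \<le> 2 / V k"
proof -
  have "1 / V (Suc k) \<le> 1 / V k" by (simp add: V_def divide_simps)
  thus ?thesis using abs_layer_le[of k z] unif_density_le[of k z] unif_density_le[of "Suc k" z]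
    by simp
qed

lemma layer_one: "layer k 1 = 1 / V k - 1 / V (Suc k)"
  by (simp add: layer_def unif_density_def)

text \<open>
  Every operator of interest acts on these functions by multiplying the coefficients \<open>c\<close>: they are to
  the point mass what functions of the Laplacian are to the Laplacian.
\<close>

definition synth :: "(nat \<Rightarrow> real) \<Rightarrow> nat perm \<Rightarrow> real" where
  "synth c z = (\<Sum>k. c k * layer k z)"

lemma summable_inverse_V_scaled: "summable (\<lambda>k. B * (2 / V k))"
  using summable_mult[OF summable_inverse_V, of "2 * B"] by (simp add: mult_ac)

lemma abs_synth_term_le:
  assumes "\<And>k. \<bar>c k\<bar> \<le> B"
  shows "\<bar>c k * layer k z\<bar> \<le> B * (2 / V k)"
  unfolding abs_mult by (intro mult_mono assms abs_layer_le_V) (use assms[of 0] in auto)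

lemma summable_abs_synth:
  assumes "\<And>k. \<bar>c k\<bar> \<le> B"
  shows "summable (\<lambda>k. \<bar>c k * layer k z\<bar>)"
  by (rule summable_comparison_test'[OF summable_inverse_V_scaled[of B], where N = 0])
     (use abs_synth_term_le[OF assms] in auto)

lemma summable_synth:
  assumes "\<And>k. \<bar>c k\<bar> \<le> B"
  shows "summable (\<lambda>k. c k * layer k z)"
  using summable_abs_synth[OF assms] by (rule summable_rabs_cancel)

text \<open>
  The groups are closed under inversion. This makes averaging over left translates, as in a
  convolution, the same as averaging over right translates, as in the Laplacian.
\<close>

lemma synth_inverse: "synth c (inverse z) = synth c z"
  by (simp add: synth_def layer_def unif_density_inverse)

text \<open>
  The sum over the layers telescopes, and \<open>GG 0\<close> is trivial.
\<close>

lemma synth_const_1: "synth (\<lambda>_. 1) = indicator {1}"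
proof
  fix z
  have "(\<lambda>k. unif_density k z) \<longlonglongrightarrow> 0"
    by (rule tendsto_sandwich[OF _ _ tendsto_const inverse_V_tendsto_0])
       (auto simp: unif_density_le)
  hence "(\<lambda>k. layer k z) sums (unif_density 0 z - 0)"
    unfolding layer_def by (rule telescope_sums')
  thus "synth (\<lambda>_. 1) z = indicator {1} z"
    by (simp add: synth_def sums_iff unif_density_def GG_0 V_def)
qed

lemma average_synth:
  assumes "\<And>k. \<bar>c k\<bar> \<le> B"
  shows "(1 / V i) * (\<Sum>g\<in>GG i. synth c (z * g)) = synth (\<lambda>k. if i \<le> k then c k else 0) z"
proof -
  have "(\<Sum>g\<in>GG i. synth c (z * g)) = (\<Sum>k. \<Sum>g\<in>GG i. c k * layer k (z * g))"
    unfolding synth_def by (rule suminf_sum[symmetric]) (rule summable_synth[OF assms])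
  hence "(1 / V i) * (\<Sum>g\<in>GG i. synth c (z * g)) =
         (\<Sum>k. (1 / V i) * (\<Sum>g\<in>GG i. c k * layer k (z * g)))"
    using suminf_mult[OF summable_sum, of "GG i" "\<lambda>g k. c k * layer k (z * g)" "1 / V i"]
      summable_synth[of c B] assms by simp
  also have "\<dots> = (\<Sum>k. c k * ((1 / V i) * (\<Sum>g\<in>GG i. layer k (z * g))))"
    by (simp add: sum_distrib_left mult_ac)
  also have "\<dots> = (\<Sum>k. (if i \<le> k then c k else 0) * layer k z)"
    unfolding average_layer by (intro suminf_cong) auto
  finally show ?thesis by (simp add: synth_def)
qed

lemma synth_diff:
  assumes "\<And>k. \<bar>c k\<bar> \<le> B" "\<And>k. \<bar>d k\<bar> \<le> B'"
  shows "synth c z - synth d z = synth (\<lambda>k. c k - d k) z"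
  unfolding synth_def
  using suminf_diff[OF summable_synth[of c B z] summable_synth[of d B' z]] assms
  by (simp add: algebra_simps)

text \<open>
  Both the Laplacian and the convolution are series of averaging operators, with coefficients \<open>a\<close>; the
  \<open>i\<close>-th summand changes the coefficients on the eigenspaces to \<open>m i\<close>. Since \<open>\<bar>layer k z\<bar>\<close> is at most
  \<open>2 / V k\<close>, the double series converges absolutely and the order of summation may be exchanged.
\<close>

lemma suminf_synth:
  fixes a :: "nat \<Rightarrow> real"
  assumes a: "summable (\<lambda>i. \<bar>a i\<bar>)" and m: "\<And>i k. \<bar>m i k\<bar> \<le> B"
  shows "(\<Sum>i. a i * synth (m i) z) = synth (\<lambda>k. \<Sum>i. a i * m i k) z"
proof -
  let ?f = "\<lambda>(i, k). a i * m i k * layer k z"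
  have B: "B \<ge> 0" using m[of 0 0] by auto
  have V: "(\<lambda>k. 2 / V k) summable_on UNIV"
    using summable_inverse_V_scaled[of 1] by (intro norm_summable_imp_summable_on) simp
  have A: "(\<lambda>i. \<bar>a i\<bar> * B) summable_on UNIV"
    using summable_mult2[OF a, of B] B by (intro norm_summable_imp_summable_on) (simp add: abs_mult)
  have dom: "(\<lambda>(i, k). (\<bar>a i\<bar> * B) * (2 / V k)) summable_on UNIV \<times> UNIV"
  proof (rule summable_on_SigmaI)
    show "((\<lambda>k. case (i, k) of (i, k) \<Rightarrow> (\<bar>a i\<bar> * B) * (2 / V k)) has_sum
            (\<bar>a i\<bar> * B) * (\<Sum>\<^sub>\<infinity>k. 2 / V k)) UNIV" for i
      using has_sum_cmult_right[OF has_sum_infsum[OF V]] by simp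
  qed (use summable_on_cmult_left[OF A] B in auto)
  have sm: "?f summable_on UNIV \<times> UNIV"
  proof (rule abs_summable_summable[OF Infinite_Sum.abs_summable_on_comparison_test'[OF dom]])
    fix x :: "nat \<times> nat" assume "x \<in> UNIV \<times> UNIV"
    obtain i k where x: "x = (i, k)" by (cases x)
    have le: "\<bar>m i k * layer k z\<bar> \<le> B * (2 / V k)"
      unfolding abs_mult by (intro mult_mono m abs_layer_le_V B) auto
    thus "norm (?f x) \<le> (case x of (i, k) \<Rightarrow> \<bar>a i\<bar> * B * (2 / V k))"
      using mult_left_mono[OF le, of "\<bar>a i\<bar>"] unfolding x by (simp add: abs_mult mult_ac)
  qed
  have sum_abs_i: "summable (\<lambda>i. \<bar>a i * m i k\<bar>)" for k
    by (rule summable_comparison_test'[OF summable_mult2[OF a, of B], where N = 0])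
       (auto simp: abs_mult m mult_left_mono)
  have inner: "(\<Sum>\<^sub>\<infinity>k. ?f (i, k)) = a i * synth (m i) z" for i
  proof -
    have "(\<Sum>\<^sub>\<infinity>k. m i k * layer k z) = synth (m i) z"
      unfolding synth_def using summable_abs_synth[of "m i" B z] m
      by (intro infsumI norm_summable_imp_has_sum) (auto intro: summable_sums summable_rabs_cancel)
    moreover have "(\<Sum>\<^sub>\<infinity>k. ?f (i, k)) = a i * (\<Sum>\<^sub>\<infinity>k. m i k * layer k z)"
      by (simp add: mult.assoc infsum_cmult_right')
    ultimately show ?thesis by simp
  qed
  have inner': "(\<Sum>\<^sub>\<infinity>i. ?f (i, k)) = (\<Sum>i. a i * m i k) * layer k z" for k
  proof -
    have "(\<Sum>\<^sub>\<infinity>i. a i * m i k) = (\<Sum>i. a i * m i k)"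
      using sum_abs_i[of k]
      by (intro infsumI norm_summable_imp_has_sum) (auto intro: summable_sums summable_rabs_cancel)
    thus ?thesis by (simp add: infsum_cmult_left')
  qed
  have Ba: "\<bar>\<Sum>i. a i * m i k\<bar> \<le> (\<Sum>i. \<bar>a i\<bar> * B)" for k
  proof -
    have "\<bar>\<Sum>i. a i * m i k\<bar> \<le> (\<Sum>i. \<bar>a i * m i k\<bar>)" by (rule summable_rabs[OF sum_abs_i])
    also have "\<dots> \<le> (\<Sum>i. \<bar>a i\<bar> * B)"
      by (rule suminf_le[OF _ sum_abs_i summable_mult2[OF a]]) (auto simp: abs_mult m mult_left_mono)
    finally show ?thesis .
  qed
  have s1: "(\<lambda>i. a i * synth (m i) z) summable_on UNIV"
    using summable_on_Sigma_banach[OF sm] by (simp add: inner[simplified])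
  have s2: "summable (\<lambda>k. \<bar>(\<Sum>i. a i * m i k) * layer k z\<bar>)"
    by (rule summable_abs_synth[OF Ba])
  have "(\<Sum>i. a i * synth (m i) z) = (\<Sum>\<^sub>\<infinity>i. a i * synth (m i) z)"
    by (rule sums_unique[symmetric], rule has_sum_imp_sums) (rule has_sum_infsum[OF s1])
  also have "\<dots> = (\<Sum>\<^sub>\<infinity>i. \<Sum>\<^sub>\<infinity>k. ?f (i, k))" by (simp only: inner)
  also have "\<dots> = (\<Sum>\<^sub>\<infinity>k. \<Sum>\<^sub>\<infinity>i. ?f (i, k))"
    using infsum_swap_banach[of "\<lambda>i k. ?f (i, k)" UNIV UNIV] sm by simp
  also have "\<dots> = (\<Sum>\<^sub>\<infinity>k. (\<Sum>i. a i * m i k) * layer k z)" by (simp only: inner')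
  also have "\<dots> = (\<Sum>k. (\<Sum>i. a i * m i k) * layer k z)"
    using s2 by (intro infsumI norm_summable_imp_has_sum)
      (auto intro: summable_sums summable_rabs_cancel)
  finally show ?thesis by (simp add: synth_def)
qed

section \<open>Convergence in the Hilbert space\<close>

text \<open>
  A square summable function that dominates, up to a constant, every \<open>synth c\<close> with bounded \<open>c\<close>. It reduces
  convergence in the Hilbert space to convergence of each coefficient.
\<close>

definition envelope :: "nat perm \<Rightarrow> real" where
  "envelope z = (\<Sum>k. unif_density k z)"

lemma summable_unif_density: "summable (\<lambda>k. unif_density k z)"
  by (rule summable_comparison_test'[OF summable_inverse_V, where N = 0])
     (simp add: unif_density_le)

lemma envelope_nonneg [simp]: "envelope z \<ge> 0"
  unfolding envelope_def by (rule suminf_nonneg[OF summable_unif_density]) simp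

lemma abs_synth_le_envelope:
  assumes "\<And>k. \<bar>c k\<bar> \<le> B"
  shows "\<bar>synth c z\<bar> \<le> 2 * B * envelope z"
proof -
  have B: "B \<ge> 0" using assms[of 0] by auto
  have s: "summable (\<lambda>k. unif_density (Suc k) z)"
    using summable_unif_density by (subst summable_Suc_iff)
  have "\<bar>synth c z\<bar> \<le> (\<Sum>k. \<bar>c k * layer k z\<bar>)"
    unfolding synth_def by (rule summable_rabs[OF summable_abs_synth[OF assms]])
  also have "\<dots> \<le> (\<Sum>k. B * (unif_density k z + unif_density (Suc k) z))"
  proof (rule suminf_le[OF _ summable_abs_synth[OF assms]])
    show "\<bar>c k * layer k z\<bar> \<le> B * (unif_density k z + unif_density (Suc k) z)" for k
      unfolding abs_mult by (intro mult_mono assms abs_layer_le B) auto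
  qed (intro summable_mult summable_add summable_unif_density s)
  also have "\<dots> = B * (envelope z + (\<Sum>k. unif_density (Suc k) z))"
    unfolding envelope_def
    by (simp add: suminf_mult suminf_add summable_add summable_unif_density s)
  also have "\<dots> \<le> B * (envelope z + envelope z)"
  proof (intro mult_left_mono add_left_mono B)
    show "(\<Sum>k. unif_density (Suc k) z) \<le> envelope z"
      unfolding envelope_def using suminf_split_head[OF summable_unif_density, of z] by simp
  qed
  finally show ?thesis by simp
qed

text \<open>
  Since \<open>V\<close> grows at least geometrically, the envelope at a point is dominated by the density of the
  smallest of the groups containing that point.
\<close>

lemma envelope_le_unif_density: "\<exists>j. envelope z \<le> 2 * unif_density j z"
proof -
  define j where "j = (LEAST k. z \<in> GG k)"
  have j: "z \<in> GG j" unfolding j_def using GG_exhaust by (rule LeastI_ex)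
  have "unif_density k z = 0" if "k < j" for k
    using not_less_Least[of k "\<lambda>k. z \<in> GG k"] that by (auto simp: unif_density_def j_def)
  hence "envelope z = (\<Sum>n. unif_density (n + j) z)"
    unfolding envelope_def using suminf_split_initial_segment[OF summable_unif_density, of z j] by simp
  also have "\<dots> \<le> (\<Sum>n. (1 / V j) * (1 / 2) ^ n)"
  proof (rule suminf_le)
    show "unif_density (n + j) z \<le> 1 / V j * (1 / 2) ^ n" for n
      using unif_density_le[of "n + j" z] inverse_V_add_le[of j n] by (simp add: add.commute)
  qed (use summable_unif_density[of z] in
      \<open>auto intro!: summable_mult summable_divide summable_geometric simp: summable_iff_shift[of "\<lambda>k. unif_density k z"]\<close>)
  also have "\<dots> = 2 * (1 / V j)"
    by (subst suminf_mult) (auto simp: suminf_geometric)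
  also have "1 / V j = unif_density j z" using j by (simp add: unif_density_def)
  finally show ?thesis by blast
qed

text \<open>
  By the previous bound the square is at most four times the sum of the squared densities, and the
  \<open>k\<close>-th of these has total mass \<open>1 / V k\<close>.
\<close>

lemma envelope_square_summable: "(\<lambda>z. (envelope z)\<^sup>2) summable_on UNIV"
proof (rule nonneg_bdd_above_summable_on)
  show "bdd_above (sum (\<lambda>z. (envelope z)\<^sup>2) ` {X. X \<subseteq> UNIV \<and> finite X})"
  proof (intro bdd_aboveI2)
    fix X :: "nat perm set" assume "X \<in> {X. X \<subseteq> UNIV \<and> finite X}"
    hence X: "finite X" by simp
    have s: "summable (\<lambda>k. 4 * (unif_density k z)\<^sup>2)" for z
    proof (rule summable_mult, rule summable_comparison_test'[OF summable_unif_density, where N = 0])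
      fix k
      have "1 / V k \<le> 1" using fact_ge_1[of "k + 1"] by (simp only: V_def) simp
      with unif_density_le[of k z] have "unif_density k z \<le> 1" by (rule order_trans)
      thus "norm ((unif_density k z)\<^sup>2) \<le> unif_density k z"
        by (simp add: power2_eq_square mult_left_le)
    qed
    have "(envelope z)\<^sup>2 \<le> (\<Sum>k. 4 * (unif_density k z)\<^sup>2)" for z
    proof -
      obtain j where "envelope z \<le> 2 * unif_density j z" using envelope_le_unif_density by blast
      hence "(envelope z)\<^sup>2 \<le> (2 * unif_density j z)\<^sup>2" by (intro power_mono) auto
      also have "\<dots> = (\<Sum>k\<in>{j}. 4 * (unif_density k z)\<^sup>2)" by (simp add: power_mult_distrib)
      also have "\<dots> \<le> (\<Sum>k. 4 * (unif_density k z)\<^sup>2)" by (rule sum_le_suminf[OF s]) auto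
      finally show ?thesis .
    qed
    hence "(\<Sum>z\<in>X. (envelope z)\<^sup>2) \<le> (\<Sum>z\<in>X. \<Sum>k. 4 * (unif_density k z)\<^sup>2)" by (rule sum_mono)
    also have "\<dots> = (\<Sum>k. \<Sum>z\<in>X. 4 * (unif_density k z)\<^sup>2)" by (rule suminf_sum[symmetric]) (rule s)
    also have "\<dots> \<le> (\<Sum>k. 4 * (1 / V k))"
    proof (rule suminf_le)
      fix k
      have "(\<Sum>z\<in>X. 4 * (unif_density k z)\<^sup>2) \<le> (\<Sum>z\<in>X. 4 * (1 / V k) * unif_density k z)"
      proof (rule sum_mono)
        show "4 * (unif_density k z)\<^sup>2 \<le> 4 * (1 / V k) * unif_density k z" for z
          using mult_right_mono[OF unif_density_le unif_density_nonneg, of k z k z]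
          by (simp add: power2_eq_square)
      qed
      also have "\<dots> = 4 * (1 / V k) * (\<Sum>z\<in>X. unif_density k z)"
        by (rule sum_distrib_left[symmetric])
      also have "\<dots> \<le> 4 * (1 / V k) * 1"
      proof (rule mult_left_mono)
        have "(\<Sum>z\<in>X. unif_density k z) \<le> (\<Sum>z\<in>X \<union> GG k. unif_density k z)"
          using X by (intro sum_mono2) auto
        also have "\<dots> = (\<Sum>z\<in>GG k. unif_density k z)"
          using X by (intro sum.mono_neutral_right) (auto simp: unif_density_def)
        also have "\<dots> = 1"
          by (simp add: unif_density_def card_GG flip: sum_divide_distrib)
        finally show "(\<Sum>z\<in>X. unif_density k z) \<le> 1" .
      qed simp
      finally show "(\<Sum>z\<in>X. 4 * (unif_density k z)\<^sup>2) \<le> 4 * (1 / V k)" by simp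
    qed (auto intro: summable_sum s summable_mult summable_inverse_V summable_divide simp del: times_divide_eq_right)
    finally show "(\<Sum>z\<in>X. (envelope z)\<^sup>2) \<le> (\<Sum>k. 4 * (1 / V k))" .
  qed
qed simp

text \<open>
  Dominated convergence for the counting measure.
\<close>

lemma infsum_dominated_tendsto_0:
  fixes g :: "nat \<Rightarrow> 'a \<Rightarrow> real"
  assumes G: "G summable_on UNIV"
    and dom: "\<And>n z. \<bar>g n z\<bar> \<le> G z"
    and lim: "\<And>z. (\<lambda>n. g n z) \<longlonglongrightarrow> 0"
  shows "(\<lambda>n. \<Sum>\<^sub>\<infinity>z. g n z) \<longlonglongrightarrow> 0"
proof -
  have G0: "G z \<ge> 0" for z using dom[of 0 z] by auto
  have Gi: "integrable (count_space UNIV) G"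
    using summable_on_iff_abs_summable_on_real[THEN iffD1, OF G]
    by (simp only: abs_summable_equivalent abs_summable_on_def)
  have gi: "infsetsum (g n) UNIV = (\<Sum>\<^sub>\<infinity>z. g n z)" for n
  proof (rule infsetsum_infsum)
    show "Infinite_Set_Sum.abs_summable_on (g n) UNIV"
      unfolding abs_summable_on_def
      by (rule Bochner_Integration.integrable_bound[OF Gi]) (use dom G0 in auto)
  qed
  have "(\<lambda>n. \<integral>z. g n z \<partial>count_space UNIV) \<longlonglongrightarrow> (\<integral>z. 0 \<partial>count_space (UNIV :: 'a set))"
    by (rule integral_dominated_convergence[where w = G]) (use Gi lim dom in auto)
  thus ?thesis using gi by (simp add: infsetsum_def)
qed

lemma envelope_translate_summable: "(\<lambda>x. (envelope (inverse y * x))\<^sup>2) summable_on UNIV"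
proof -
  have "bij_betw (\<lambda>x. inverse y * x) UNIV (UNIV :: nat perm set)"
    by (rule bij_betw_byWitness[where f' = "\<lambda>x. y * x"]) (auto simp flip: mult.assoc)
  from summable_on_reindex_bij_betw[OF this, of "\<lambda>z. (envelope z)\<^sup>2"] envelope_square_summable
  show ?thesis by simp
qed

lemma synth_translate_in_ell2:
  assumes "\<And>k. \<bar>c k\<bar> \<le> B"
  shows "(\<lambda>x. synth c (inverse y * x)) \<in> ell2"
proof -
  have "norm ((synth c z)\<^sup>2) \<le> (2 * B)\<^sup>2 * (envelope z)\<^sup>2" for z
    using power_mono[OF abs_synth_le_envelope[of c B z] abs_ge_zero, of 2] assms
    by (simp add: power_mult_distrib)
  from abs_summable_summable[OF Infinite_Sum.abs_summable_on_comparison_test'[OF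
      summable_on_cmult_right[OF envelope_translate_summable[of y]] this]]
  have "(\<lambda>x. (synth c (inverse y * x))\<^sup>2) summable_on UNIV" .
  thus ?thesis by (simp add: ell2_def)
qed

text \<open>
  Pointwise convergence is Tannery's theorem for the series over \<open>k\<close>; it becomes convergence in norm
  because all the functions have a common multiple of the envelope as a majorant.
\<close>

lemma ell2_tendsto_synth:
  assumes c: "\<And>n k. \<bar>c n k\<bar> \<le> B" and lim: "\<And>k. (\<lambda>n. c n k) \<longlonglongrightarrow> d k"
  shows "ell2_tendsto (\<lambda>n x. synth (c n) (inverse y * x)) (\<lambda>x. synth d (inverse y * x))"
proof -
  have d: "\<bar>d k\<bar> \<le> B" for k
    by (rule tendsto_upperbound[OF tendsto_rabs[OF lim]]) (use c in auto)
  have cd: "\<bar>c n k - d k\<bar> \<le> 2 * B" for n k using c[of n k] d[of k] by linarith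
  have eq: "synth (c n) z - synth d z = synth (\<lambda>k. c n k - d k) z" for n z
    by (rule synth_diff[of "c n" B d B]) (use c d in auto)
  have pt: "(\<lambda>n. synth (\<lambda>k. c n k - d k) z) \<longlonglongrightarrow> 0" for z
  proof -
    have "(\<lambda>n. \<Sum>k. (c n k - d k) * layer k z) \<longlonglongrightarrow> (\<Sum>k. 0)"
    proof (rule tannerys_theorem[THEN conjunct2, THEN conjunct2])
      show "(\<lambda>n. (c n k - d k) * layer k z) \<longlonglongrightarrow> 0" for k
        using tendsto_mult_right[OF LIM_zero[OF lim[of k]], of "layer k z"] by simp
      show "\<forall>\<^sub>F (k, n) in sequentially \<times>\<^sub>F sequentially.
              norm ((c n k - d k) * layer k z) \<le> 2 * B * (2 / V k)"
        by (intro always_eventually) (use abs_synth_term_le[OF cd] in auto)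
    qed (use summable_inverse_V_scaled[of "2 * B"] in auto)
    thus ?thesis by (simp add: synth_def)
  qed
  have "(\<lambda>n. \<Sum>\<^sub>\<infinity>x. (synth (\<lambda>k. c n k - d k) (inverse y * x))\<^sup>2) \<longlonglongrightarrow> 0"
  proof (rule infsum_dominated_tendsto_0)
    show "(\<lambda>x. (4 * B)\<^sup>2 * (envelope (inverse y * x))\<^sup>2) summable_on UNIV"
      by (rule summable_on_cmult_right[OF envelope_translate_summable])
    show "\<bar>(synth (\<lambda>k. c n k - d k) (inverse y * x))\<^sup>2\<bar> \<le> (4 * B)\<^sup>2 * (envelope (inverse y * x))\<^sup>2" for n x
      using power_mono[OF abs_synth_le_envelope[of "\<lambda>k. c n k - d k", OF cd] abs_ge_zero, of "inverse y * x" 2]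
      by (simp add: power_mult_distrib)
    show "(\<lambda>n. (synth (\<lambda>k. c n k - d k) (inverse y * x))\<^sup>2) \<longlonglongrightarrow> 0" for x
      using tendsto_power[OF pt[of "inverse y * x"], of 2] by simp
  qed
  hence "(\<lambda>n. ell2_norm (\<lambda>x. synth (c n) (inverse y * x) - synth d (inverse y * x))) \<longlonglongrightarrow> 0"
    unfolding ell2_norm_def eq using tendsto_real_sqrt by fastforce
  thus ?thesis unfolding ell2_tendsto_def using synth_translate_in_ell2 c d by blast
qed


section \<open>The heat kernel\<close>

lemma ell2_diff:
  fixes f g :: "'a \<Rightarrow> real"
  assumes "f \<in> ell2" "g \<in> ell2"
  shows "(\<lambda>x. f x - g x) \<in> ell2"
proof -
  have s: "(\<lambda>x. 2 * (f x)\<^sup>2 + 2 * (g x)\<^sup>2) summable_on UNIV"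
    using assms by (intro summable_on_add summable_on_cmult_right) (auto simp: ell2_def)
  have le: "norm ((f x - g x)\<^sup>2) \<le> 2 * (f x)\<^sup>2 + 2 * (g x)\<^sup>2" for x
  proof -
    have "(f x - g x)\<^sup>2 + (f x + g x)\<^sup>2 = 2 * (f x)\<^sup>2 + 2 * (g x)\<^sup>2"
      by (simp add: power2_eq_square algebra_simps)
    moreover have "(f x + g x)\<^sup>2 \<ge> 0" by simp
    moreover have "norm ((f x - g x)\<^sup>2) = (f x - g x)\<^sup>2" by simp
    ultimately show ?thesis by linarith
  qed
  show ?thesis
    using abs_summable_summable[OF Infinite_Sum.abs_summable_on_comparison_test'[OF s le]]
    by (simp add: ell2_def)
qed

lemma abs_le_ell2_norm:
  assumes "f \<in> ell2"
  shows "\<bar>f x\<bar> \<le> ell2_norm f"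
proof -
  have "(\<Sum>\<^sub>\<infinity>y\<in>{x}. (f y)\<^sup>2) \<le> (\<Sum>\<^sub>\<infinity>y. (f y)\<^sup>2)"
    using assms by (intro infsum_mono_neutral) (auto simp: ell2_def)
  hence "sqrt ((f x)\<^sup>2) \<le> ell2_norm f" unfolding ell2_norm_def by (intro real_sqrt_le_mono) simp
  thus ?thesis by simp
qed

lemma abs_diff_le_ell2_norm:
  assumes "ell2_tendsto F f"
  shows "\<bar>F n x - f x\<bar> \<le> ell2_norm (\<lambda>x. F n x - f x)"
proof -
  from assms have "F n \<in> ell2" "f \<in> ell2" by (simp_all add: ell2_tendsto_def)
  thus ?thesis by (rule abs_le_ell2_norm[OF ell2_diff])
qed

lemma ell2_tendsto_pointwise:
  assumes "ell2_tendsto F f"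
  shows "(\<lambda>n. F n x) \<longlonglongrightarrow> f x"
proof (rule LIM_zero_cancel)
  have lim: "(\<lambda>n. ell2_norm (\<lambda>x. F n x - f x)) \<longlonglongrightarrow> 0"
    using assms by (simp add: ell2_tendsto_def)
  show "(\<lambda>n. F n x - f x) \<longlonglongrightarrow> 0"
    by (rule Lim_null_comparison[OF _ lim]) (simp add: abs_diff_le_ell2_norm[OF assms])
qed

text \<open>
  Norm convergence controls the functions uniformly in \<open>x\<close>, because the supremum of a function is at most
  its norm in \<^const>\<open>ell2\<close>.
\<close>

lemma ell2_tendsto_uniformly_bounded:
  assumes "ell2_tendsto F f"
  shows "\<exists>M. \<forall>n x. \<bar>F n x\<bar> \<le> M"
proof -
  have lim: "(\<lambda>n. ell2_norm (\<lambda>x. F n x - f x)) \<longlonglongrightarrow> 0" and f: "f \<in> ell2"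
    using assms by (simp_all add: ell2_tendsto_def)
  from lim have "Bseq (\<lambda>n. ell2_norm (\<lambda>x. F n x - f x))"
    by (intro convergent_imp_Bseq convergentI)
  then obtain K where K: "\<And>n. norm (ell2_norm (\<lambda>x. F n x - f x)) \<le> K" by (auto simp: Bseq_def)
  have "\<bar>F n x\<bar> \<le> ell2_norm f + K" for n x
    using abs_diff_le_ell2_norm[OF assms, of n x] abs_le_ell2_norm[OF f, of x] K[of n]
    unfolding real_norm_def by linarith
  thus ?thesis by blast
qed

lemma sum_level_ball: "(\<Sum>y\<in>level_ball x k. f y) = (\<Sum>g\<in>GG k. f (x * g))"
proof -
  have "inj_on (\<lambda>g. x * g) (GG k)"
    by (rule inj_on_inverseI[where g = "\<lambda>g. inverse x * g"]) (simp flip: mult.assoc)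
  thus ?thesis unfolding level_ball_def by (simp add: sum.reindex)
qed

lemma synth_sum:
  assumes "\<And>n k. \<bar>c n k\<bar> \<le> B n"
  shows "(\<Sum>n<N. a n * synth (c n) z) = synth (\<lambda>k. \<Sum>n<N. a n * c n k) z"
proof -
  have s: "summable (\<lambda>k. a n * (c n k * layer k z))" for n
    by (rule summable_mult[OF summable_synth[OF assms]])
  have "(\<Sum>n<N. a n * synth (c n) z) = (\<Sum>n<N. \<Sum>k. a n * (c n k * layer k z))"
    unfolding synth_def by (intro sum.cong refl suminf_mult[OF summable_synth[OF assms], symmetric])
  also have "\<dots> = (\<Sum>k. \<Sum>n<N. a n * (c n k * layer k z))"
    by (rule suminf_sum[symmetric]) (rule s)
  also have "\<dots> = synth (\<lambda>k. \<Sum>n<N. a n * c n k) z"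
    unfolding synth_def by (simp only: sum_distrib_right mult.assoc)
  finally show ?thesis .
qed

text \<open>
  Truncating the coefficients puts a synthesised function into the domain of the Laplacian before its
  closure is taken.
\<close>

lemma finite_support_synth:
  assumes "\<And>k. k \<ge> n \<Longrightarrow> c k = 0"
  shows "finite {x. synth c (inverse y * x) \<noteq> 0}"
proof (rule finite_subset)
  show "{x. synth c (inverse y * x) \<noteq> 0} \<subseteq> (\<lambda>g. y * g) ` GG n"
  proof
    fix x assume "x \<in> {x. synth c (inverse y * x) \<noteq> 0}"
    hence "(\<lambda>k. c k * layer k (inverse y * x)) \<noteq> (\<lambda>_. 0)" unfolding synth_def by auto
    then obtain k where k: "c k * layer k (inverse y * x) \<noteq> 0" by blast
    hence "k < n" using assms[of k] by (cases "k < n") auto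
    moreover have "inverse y * x \<in> GG (Suc k)"
      using k GG_mono[of k "Suc k"] 
      by (cases "inverse y * x \<in> GG k"; cases "inverse y * x \<in> GG (Suc k)")
         (auto simp: layer_def unif_density_def)
    ultimately have "inverse y * x \<in> GG n" using GG_mono[of "Suc k" n] by auto
    thus "x \<in> (\<lambda>g. y * g) ` GG n"
      by (intro image_eqI[of _ _ "inverse y * x"]) (simp flip: mult.assoc)
  qed
qed simp

locale decreasing_spectrum =
  fixes Lam :: "real \<Rightarrow> real"
  assumes eigenval_Suc_le: "\<And>k. k \<ge> 1 \<Longrightarrow> eigenval Lam (Suc k) \<le> eigenval Lam k"
    and eigenval_tendsto_0: "eigenval Lam \<longlonglongrightarrow> 0"
begin

lemma lap_coeff_nonneg: "lap_coeff Lam (Suc i) \<ge> 0"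
  using eigenval_Suc_le[of "Suc i"] by (simp add: lap_coeff_def)

lemma eigenval_decreasing: "eigenval Lam (Suc (i + k)) \<le> eigenval Lam (Suc k)"
proof (induction i)
  case (Suc i)
  show ?case using order_trans[OF eigenval_Suc_le[of "Suc (i + k)"] Suc] by simp
qed simp

lemma eigenval_nonneg: "eigenval Lam (Suc k) \<ge> 0"
proof (rule LIMSEQ_le_const2)
  show "(\<lambda>i. eigenval Lam (Suc (i + k))) \<longlonglongrightarrow> 0"
    using LIMSEQ_ignore_initial_segment[OF eigenval_tendsto_0, of "Suc k"] by simp
qed (use eigenval_decreasing in auto)

lemma abs_eigenval_le: "\<bar>eigenval Lam (Suc k)\<bar> \<le> eigenval Lam 1"
  using eigenval_nonneg[of k] eigenval_decreasing[of k 0] by simp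

text \<open>
  The tails of the coefficients are the eigenvalues: the \<open>k\<close>-th layer is annihilated exactly by the
  averages of level greater than \<open>k\<close>.
\<close>

lemma lap_coeff_sums: "(\<lambda>i. lap_coeff Lam (Suc (i + k))) sums eigenval Lam (Suc k)"
proof -
  have "(\<lambda>i. eigenval Lam (Suc (i + k))) \<longlonglongrightarrow> 0"
    using LIMSEQ_ignore_initial_segment[OF eigenval_tendsto_0, of "Suc k"] by simp
  from telescope_sums'[OF this] show ?thesis by (simp add: lap_coeff_def)
qed

lemma summable_lap_coeff: "summable (\<lambda>i. lap_coeff Lam (Suc i))"
  using lap_coeff_sums[of 0] by (simp add: sums_iff)

text \<open>
  In each summand the average keeps the layers \<open>k \<ge> Suc i\<close>, so the difference from the identity keeps
  the others. The layer \<open>k\<close> thus collects the coefficients from level \<open>Suc k\<close> on, whose sum is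
  \<open>eigenval Lam (Suc k)\<close>.
\<close>

lemma laplacian_synth:
  assumes c: "\<And>k. \<bar>c k\<bar> \<le> B"
  shows "laplacian Lam (\<lambda>x. synth c (inverse y * x)) =
         (\<lambda>x. synth (\<lambda>k. eigenval Lam (Suc k) * c k) (inverse y * x))"
proof
  fix x
  define z where "z = inverse y * x"
  define m where "m i k = (if Suc i \<le> k then 0 else c k)" for i k
  have B: "B \<ge> 0" using c[of 0] by auto
  have "synth c z - (1 / V (Suc i)) * (\<Sum>w\<in>level_ball x (Suc i). synth c (inverse y * w)) =
        synth (m i) z" for i
  proof -
    have "(1 / V (Suc i)) * (\<Sum>w\<in>level_ball x (Suc i). synth c (inverse y * w)) =
          synth (\<lambda>k. if Suc i \<le> k then c k else 0) z"
      using average_synth[of c B "Suc i" z] c by (simp add: sum_level_ball z_def mult.assoc)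
    moreover have "synth c z - synth (\<lambda>k. if Suc i \<le> k then c k else 0) z =
          synth (\<lambda>k. c k - (if Suc i \<le> k then c k else 0)) z"
      by (rule synth_diff[where B = B and B' = B]) (use c B in auto)
    moreover have "(\<lambda>k. c k - (if Suc i \<le> k then c k else 0)) = m i"
      by (auto simp: m_def fun_eq_iff)
    ultimately show ?thesis by simp
  qed
  hence "laplacian Lam (\<lambda>x. synth c (inverse y * x)) x =
         (\<Sum>i. lap_coeff Lam (Suc i) * synth (m i) z)"
    by (simp add: laplacian_def z_def)
  also have "\<dots> = synth (\<lambda>k. \<Sum>i. lap_coeff Lam (Suc i) * m i k) z"
    using c B lap_coeff_nonneg
    by (intro suminf_synth[where B = B]) (auto simp: m_def summable_lap_coeff)
  also have "(\<lambda>k. \<Sum>i. lap_coeff Lam (Suc i) * m i k) = (\<lambda>k. eigenval Lam (Suc k) * c k)"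
  proof
    fix k
    have "summable (\<lambda>i. lap_coeff Lam (Suc i) * m i k)"
      by (rule summable_comparison_test'[OF summable_mult2[OF summable_lap_coeff, of B], where N = 0])
         (use lap_coeff_nonneg c B in \<open>auto simp: m_def abs_mult intro: mult_left_mono\<close>)
    from suminf_split_initial_segment[OF this, of k]
    have "(\<Sum>i. lap_coeff Lam (Suc i) * m i k) = (\<Sum>i. lap_coeff Lam (Suc (i + k)) * c k)"
      by (simp add: m_def)
    also have "\<dots> = eigenval Lam (Suc k) * c k"
      using sums_mult2[OF lap_coeff_sums] by (simp add: sums_iff)
    finally show "(\<Sum>i. lap_coeff Lam (Suc i) * m i k) = eigenval Lam (Suc k) * c k" .
  qed
  finally show "laplacian Lam (\<lambda>x. synth c (inverse y * x)) x =
         synth (\<lambda>k. eigenval Lam (Suc k) * c k) (inverse y * x)" by (simp add: z_def)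
qed

text \<open>
  The reason why the closure of the Laplacian is again a function: the limit of the images of a
  convergent sequence is already determined pointwise, each value of the Laplacian being a dominated
  series of finite averages.
\<close>

lemma laplacian_pointwise_tendsto:
  assumes F: "ell2_tendsto F f"
  shows "(\<lambda>n. laplacian Lam (F n) x) \<longlonglongrightarrow> laplacian Lam f x"
proof -
  obtain M where M: "\<And>n x. \<bar>F n x\<bar> \<le> M" using ell2_tendsto_uniformly_bounded[OF F] by blast
  let ?T = "\<lambda>f k. lap_coeff Lam (Suc k) *
       (f x - (1 / V (Suc k)) * (\<Sum>y\<in>level_ball x (Suc k). f y))"
  show ?thesis unfolding laplacian_def
  proof (rule tannerys_theorem[THEN conjunct2, THEN conjunct2])
    show "(\<lambda>n. ?T (F n) k) \<longlonglongrightarrow> ?T f k" for k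
      by (intro tendsto_intros ell2_tendsto_pointwise[OF F])
    have "norm (?T (F n) k) \<le> lap_coeff Lam (Suc k) * (2 * M)" for n k
    proof -
      have "\<bar>\<Sum>g\<in>GG (Suc k). F n (x * g)\<bar> \<le> (\<Sum>g\<in>GG (Suc k). M)"
        by (intro order_trans[OF sum_abs] sum_mono M)
      hence "\<bar>(1 / V (Suc k)) * (\<Sum>g\<in>GG (Suc k). F n (x * g))\<bar> \<le> M"
        by (simp add: abs_mult card_GG divide_simps mult.commute)
      hence "\<bar>F n x - (1 / V (Suc k)) * (\<Sum>y\<in>level_ball x (Suc k). F n y)\<bar> \<le> 2 * M"
        using M[of n x] unfolding sum_level_ball by linarith
      thus ?thesis using lap_coeff_nonneg[of k] by (simp add: abs_mult mult_left_mono)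
    qed
    thus "\<forall>\<^sub>F (k, n) in sequentially \<times>\<^sub>F sequentially.
            norm (?T (F n) k) \<le> lap_coeff Lam (Suc k) * (2 * M)"
      by (intro always_eventually) auto
  qed (auto intro: summable_mult2 summable_lap_coeff)
qed

text \<open>
  Existence in the description of the closure comes from truncating the coefficients, and uniqueness from
  pointwise convergence.
\<close>

lemma laplacian_ext_synth:
  assumes c: "\<And>k. \<bar>c k\<bar> \<le> B"
  shows "laplacian_ext Lam (\<lambda>x. synth c (inverse y * x)) =
         (\<lambda>x. synth (\<lambda>k. eigenval Lam (Suc k) * c k) (inverse y * x))"
    (is "laplacian_ext Lam ?f = ?g")
  unfolding laplacian_ext_def
proof (rule the_equality)
  have B: "B \<ge> 0" using c[of 0] by auto
  define b where "b n k = (if k < n then c k else 0)" for n k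
  define F where "F n x = synth (b n) (inverse y * x)" for n x
  have b: "\<bar>b n k\<bar> \<le> B" for n k using c B by (simp add: b_def)
  have lim: "(\<lambda>n. b n k) \<longlonglongrightarrow> c k" for k
    by (rule tendsto_eventually, rule eventually_mono[OF eventually_gt_at_top[of k]])
       (simp add: b_def)
  have fin: "finite {x. F n x \<noteq> 0}" for n
    unfolding F_def by (rule finite_support_synth[of n]) (simp add: b_def)
  have "ell2_tendsto F ?f" unfolding F_def by (rule ell2_tendsto_synth[of b B, OF b lim])
  moreover have "ell2_tendsto (\<lambda>n. laplacian Lam (F n)) ?g"
  proof -
    have "laplacian Lam (F n) = (\<lambda>x. synth (\<lambda>k. eigenval Lam (Suc k) * b n k) (inverse y * x))" for n
      unfolding F_def by (rule laplacian_synth[OF b])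
    moreover have "\<bar>eigenval Lam (Suc k) * b n k\<bar> \<le> eigenval Lam 1 * B" for n k
      unfolding abs_mult using abs_eigenval_le[of 0] by (intro mult_mono abs_eigenval_le b) auto
    ultimately show ?thesis
      using ell2_tendsto_synth[of "\<lambda>n k. eigenval Lam (Suc k) * b n k" "eigenval Lam 1 * B"
          "\<lambda>k. eigenval Lam (Suc k) * c k" y] tendsto_mult_left[OF lim] by simp
  qed
  ultimately show "\<exists>F. (\<forall>n. finite {x. F n x \<noteq> 0}) \<and> ell2_tendsto F ?f \<and>
                 ell2_tendsto (\<lambda>n. laplacian Lam (F n)) ?g" using fin by blast
next
  fix g assume "\<exists>F. (\<forall>n. finite {x. F n x \<noteq> 0}) \<and> ell2_tendsto F ?f \<and>
                 ell2_tendsto (\<lambda>n. laplacian Lam (F n)) g"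
  then obtain F where F: "ell2_tendsto F ?f" "ell2_tendsto (\<lambda>n. laplacian Lam (F n)) g" by blast
  have "g x = laplacian Lam ?f x" for x
    by (rule LIMSEQ_unique[OF ell2_tendsto_pointwise[OF F(2)] laplacian_pointwise_tendsto[OF F(1)]])
  thus "g = ?g" using laplacian_synth[OF c] by auto
qed

lemma laplacian_ext_power_synth:
  assumes c: "\<And>k. \<bar>c k\<bar> \<le> B"
  shows "(laplacian_ext Lam ^^ n) (\<lambda>x. synth c (inverse y * x)) =
         (\<lambda>x. synth (\<lambda>k. eigenval Lam (Suc k) ^ n * c k) (inverse y * x))"
proof (induction n)
  case (Suc n)
  have "\<bar>eigenval Lam (Suc k) ^ n * c k\<bar> \<le> eigenval Lam 1 ^ n * B" for k
    unfolding abs_mult power_abs using abs_eigenval_le[of 0]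
    by (intro mult_mono power_mono abs_eigenval_le c) auto
  from laplacian_ext_synth[OF this] show ?case by (simp add: Suc mult.assoc)
qed simp

lemma indicator_translate_synth: "indicator {y} = (\<lambda>x. synth (\<lambda>_. 1) (inverse y * x))"
proof
  fix x
  have "inverse y * x = 1 \<longleftrightarrow> x = y"
    by (metis perm.left_inverse perm.left_cancel)
  thus "indicator {y} x = synth (\<lambda>_. 1) (inverse y * x)"
    by (auto simp: synth_const_1 indicator_def)
qed

text \<open>
  On the eigenspaces the exponential series of the operator is the exponential series of the
  eigenvalues. Its partial sums are bounded by \<open>exp (\<bar>t\<bar> * eigenval Lam 1)\<close> simultaneously for all
  eigenvalues, as the convergence theorem for coefficients requires.
\<close>

theorem heat_kernel_eq:
  "heat_kernel Lam t x y = synth (\<lambda>k. exp (- t * eigenval Lam (Suc k))) (inverse y * x)"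
proof -
  let ?a = "\<lambda>n. (- t) ^ n / fact n"
  let ?e = "\<lambda>k. eigenval Lam (Suc k)"
  let ?u = "\<lambda>x. synth (\<lambda>k. exp (- t * ?e k)) (inverse y * x)"
  have pow: "\<bar>?e k ^ n\<bar> \<le> eigenval Lam 1 ^ n" for k n
    unfolding power_abs by (intro power_mono abs_eigenval_le) auto
  have partial: "(\<lambda>N x. \<Sum>n<N. ?a n * (laplacian_ext Lam ^^ n) (indicator {y}) x) =
        (\<lambda>N x. synth (\<lambda>k. \<Sum>n<N. ?a n * ?e k ^ n) (inverse y * x))"
    unfolding indicator_translate_synth
    using laplacian_ext_power_synth[of "\<lambda>_. 1" 1] synth_sum[of "\<lambda>n k. ?e k ^ n", OF pow, of ?a]
    by simp
  have exp_term: "?a n * ?e k ^ n = (- t * ?e k) ^ n /\<^sub>R fact n" for n k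
    unfolding power_mult_distrib by (simp add: field_simps)
  have lim: "ell2_tendsto (\<lambda>N x. \<Sum>n<N. ?a n * (laplacian_ext Lam ^^ n) (indicator {y}) x) ?u"
    unfolding partial
  proof (rule ell2_tendsto_synth)
    show "(\<lambda>N. \<Sum>n<N. ?a n * ?e k ^ n) \<longlonglongrightarrow> exp (- t * ?e k)" for k
      using exp_converges[of "- t * ?e k"] unfolding exp_term sums_def .
    show "\<bar>\<Sum>n<N. ?a n * ?e k ^ n\<bar> \<le> exp (\<bar>t\<bar> * eigenval Lam 1)" for N k
    proof -
      have "\<bar>\<Sum>n<N. ?a n * ?e k ^ n\<bar> \<le> (\<Sum>n<N. \<bar>?a n * ?e k ^ n\<bar>)" by (rule sum_abs)
      also have "\<dots> \<le> (\<Sum>n<N. (\<bar>t\<bar> * eigenval Lam 1) ^ n /\<^sub>R fact n)"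
      proof (rule sum_mono)
        fix n
        have "\<bar>?a n * ?e k ^ n\<bar> = \<bar>t\<bar> ^ n / fact n * \<bar>?e k ^ n\<bar>"
          by (simp add: abs_mult power_abs)
        also have "\<dots> \<le> \<bar>t\<bar> ^ n / fact n * eigenval Lam 1 ^ n"
          by (intro mult_left_mono pow) auto
        finally show "\<bar>?a n * ?e k ^ n\<bar> \<le> (\<bar>t\<bar> * eigenval Lam 1) ^ n /\<^sub>R fact n"
          by (simp add: power_mult_distrib divide_inverse mult_ac)
      qed
      also have "\<dots> \<le> exp (\<bar>t\<bar> * eigenval Lam 1)"
      proof -
        have "0 \<le> eigenval Lam 1" using abs_eigenval_le[of 0] by linarith
        thus ?thesis unfolding exp_def by (intro sum_le_suminf summable_exp_generic) auto
      qed
      finally show ?thesis .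
    qed
  qed
  have "heat_semigroup Lam t (indicator {y}) = ?u"
    unfolding heat_semigroup_def
  proof (rule the_equality, rule lim)
    fix v assume v: "ell2_tendsto (\<lambda>N x. \<Sum>n<N. ?a n * (laplacian_ext Lam ^^ n) (indicator {y}) x) v"
    show "v = ?u"
      using LIMSEQ_unique[OF ell2_tendsto_pointwise[OF v] ell2_tendsto_pointwise[OF lim]] by blast
  qed
  thus ?thesis by (simp add: heat_kernel_def)
qed

section \<open>The return probability\<close>

lemma level_weight_nonneg: "level_weight Lam k \<ge> 0"
  using eigenval_Suc_le[of k] by (simp add: level_weight_def)

lemma sum_level_weight: "(\<Sum>i\<le>k. level_weight Lam i) = exp (- eigenval Lam (Suc k))"
  by (induction k) (simp_all add: level_weight_def)

lemma level_weight_sums: "level_weight Lam sums 1"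
proof -
  have "(\<lambda>k. exp (- eigenval Lam (Suc k))) \<longlonglongrightarrow> exp (- 0)"
    by (intro tendsto_intros LIMSEQ_Suc eigenval_tendsto_0)
  hence "(\<lambda>k. \<Sum>i\<le>k. level_weight Lam i) \<longlonglongrightarrow> 1" by (simp add: sum_level_weight)
  thus ?thesis by (simp add: sums_def_le)
qed

lemma pmf_level_weight: "pmf (embed_pmf (level_weight Lam)) k = level_weight Lam k"
proof (rule pmf_embed_pmf[OF level_weight_nonneg])
  show "(\<integral>\<^sup>+k. ennreal (level_weight Lam k) \<partial>count_space UNIV) = 1"
    using suminf_ennreal_eq[OF level_weight_nonneg level_weight_sums]
    by (simp add: nn_integral_count_space_nat)
qed

text \<open>
  One step multiplies the coefficient of layer \<open>k\<close> by the total weight of the levels \<open>i \<le> k\<close>, whose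
  averages keep that layer. By the choice of the weights this is \<open>exp (- eigenval Lam (Suc k))\<close>.
\<close>

lemma pmf_conv_power:
  "pmf (conv_power (step_pmf Lam) n) z = synth (\<lambda>k. exp (- eigenval Lam (Suc k)) ^ n) z"
proof (induction n arbitrary: z)
  case 0
  show ?case by (simp add: synth_const_1 pmf_return indicator_def)
next
  case (Suc n)
  let ?c = "\<lambda>k. exp (- eigenval Lam (Suc k)) ^ n"
  let ?\<nu> = "conv_power (step_pmf Lam) n"
  let ?m = "\<lambda>i k. if i \<le> k then ?c k else 0"
  have c: "\<bar>?c k\<bar> \<le> 1" for k using eigenval_nonneg[of k] by (simp add: power_le_one)
  have shift: "pmf (map_pmf (\<lambda>h. g * h) ?\<nu>) z = synth ?c (inverse z * g)" for g
  proof -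
    have inj: "inj (\<lambda>h. g * h)"
      by (rule inj_on_inverseI[where g = "\<lambda>h. inverse g * h"]) (simp flip: mult.assoc)
    have "pmf (map_pmf (\<lambda>h. g * h) ?\<nu>) (g * (inverse g * z)) = pmf ?\<nu> (inverse g * z)"
      by (rule pmf_map_inj'[OF inj])
    also have "g * (inverse g * z) = z" by (simp flip: mult.assoc)
    finally show ?thesis using synth_inverse[of ?c "inverse g * z"] by (simp add: Suc.IH)
  qed
  have avg: "pmf (bind_pmf (pmf_of_set (GG i)) (\<lambda>g. map_pmf (\<lambda>h. g * h) ?\<nu>)) z = synth (?m i) z" for i
  proof -
    have "GG i \<noteq> {}" using one_mem_GG[of i] by blast
    hence "pmf (bind_pmf (pmf_of_set (GG i)) (\<lambda>g. map_pmf (\<lambda>h. g * h) ?\<nu>)) z =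
          (1 / V i) * (\<Sum>g\<in>GG i. synth ?c (inverse z * g))"
      by (simp add: pmf_bind integral_pmf_of_set shift card_GG)
    also have "\<dots> = synth (?m i) (inverse z)" by (rule average_synth[OF c])
    finally show ?thesis by (simp add: synth_inverse)
  qed
  \<comment> \<open>A step is drawn by first drawing its level and then a uniform element of the group.\<close>
  have mix: "pmf (bind_pmf (step_pmf Lam) K) z =
      measure_pmf.expectation (embed_pmf (level_weight Lam))
        (\<lambda>i. pmf (bind_pmf (pmf_of_set (GG i)) K) z)" for K
    unfolding step_pmf_def bind_assoc_pmf by (rule pmf_bind)
  have "pmf (conv_power (step_pmf Lam) (Suc n)) z =
        measure_pmf.expectation (embed_pmf (level_weight Lam)) (\<lambda>i. synth (?m i) z)"
    unfolding conv_power.simps mix avg ..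
  also have "\<dots> = infsetsum (\<lambda>i. level_weight Lam i * synth (?m i) z) UNIV"
    by (simp only: pmf_expectation_eq_infsetsum pmf_level_weight)
  also have "\<dots> = (\<Sum>i. level_weight Lam i * synth (?m i) z)"
  proof (rule infsetsum_nat')
    have "\<bar>synth (?m i) z\<bar> \<le> 2 * 1 * envelope z" for i
      by (rule abs_synth_le_envelope) (use c in auto)
    hence "norm (norm (level_weight Lam i * synth (?m i) z)) \<le> level_weight Lam i * (2 * 1 * envelope z)" for i
      using mult_left_mono[OF _ level_weight_nonneg[of i]] level_weight_nonneg[of i]
      by (simp only: abs_mult real_norm_def abs_idempotent abs_of_nonneg)
    moreover have "summable (\<lambda>i. level_weight Lam i * (2 * 1 * envelope z))"
      using level_weight_sums by (intro summable_mult2) (simp add: sums_iff)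
    ultimately have "summable (\<lambda>i. norm (level_weight Lam i * synth (?m i) z))"
      by (rule summable_comparison_test'[where N = 0, rotated])
    thus "Infinite_Set_Sum.abs_summable_on (\<lambda>i. level_weight Lam i * synth (?m i) z) UNIV"
      unfolding abs_summable_on_nat_iff' .
  qed
  also have "\<dots> = synth (\<lambda>k. \<Sum>i. level_weight Lam i * ?m i k) z"
    using level_weight_nonneg level_weight_sums c
    by (intro suminf_synth[where B = 1]) (auto simp: sums_iff)
  also have "(\<lambda>k. \<Sum>i. level_weight Lam i * ?m i k) = (\<lambda>k. exp (- eigenval Lam (Suc k)) ^ Suc n)"
  proof
    fix k
    have "(\<Sum>i. level_weight Lam i * ?m i k) = (\<Sum>i\<le>k. level_weight Lam i * ?m i k)"
      by (rule suminf_finite) auto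
    also have "\<dots> = (\<Sum>i\<le>k. level_weight Lam i) * ?c k" by (simp add: sum_distrib_right)
    finally show "(\<Sum>i. level_weight Lam i * ?m i k) = exp (- eigenval Lam (Suc k)) ^ Suc n"
      by (simp add: sum_level_weight)
  qed
  finally show ?case .
qed

end

text \<open>
  The value at the identity of \<open>synth\<close> with the coefficients \<open>exp (- t * eigenval Lam (Suc k))\<close>. It serves
  real times for the heat kernel and integer times for the random walk.
\<close>

definition diag_kernel :: "(real \<Rightarrow> real) \<Rightarrow> real \<Rightarrow> real" where
  "diag_kernel Lam t = (\<Sum>k. exp (- t * eigenval Lam (Suc k)) * (1 / V k - 1 / V (Suc k)))"

context decreasing_spectrum
begin

lemma heat_kernel_diagonal: "heat_kernel Lam t x x = diag_kernel Lam t"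
  by (simp add: heat_kernel_eq diag_kernel_def synth_def layer_one)

lemma return_prob_eq: "return_prob Lam n = diag_kernel Lam (real n)"
  by (simp add: return_prob_def pmf_conv_power diag_kernel_def synth_def layer_one flip: exp_of_nat_mult)

end


section \<open>Regular variation\<close>

locale smoothly_varying_function =
  fixes \<phi> :: "real \<Rightarrow> real" and \<kappa> :: real
  assumes pos: "\<And>s. s \<ge> ln 2 \<Longrightarrow> \<phi> s > 0"
    and smooth: "smoothly_varying \<phi> \<kappa>"
begin

text \<open>
  In logarithmic coordinates this is the mean value theorem, the derivative of \<open>ln (\<phi> (exp x))\<close> being
  bounded near infinity.
\<close>

lemma log_lipschitz:
  "\<exists>K S. \<forall>s1>S. \<forall>s2>S. \<bar>ln (\<phi> s1) - ln (\<phi> s2)\<bar> \<le> K * \<bar>ln s1 - ln s2\<bar>"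
proof -
  define h where "h = (\<lambda>x. ln (\<phi> (exp x)))"
  from smooth obtain a where a: "\<And>x. x > a \<Longrightarrow> \<phi> differentiable (at x)"
    unfolding smoothly_varying_def by (metis funpow_0)
  from smooth have "(deriv h \<longlongrightarrow> \<kappa>) at_top"
    by (simp add: smoothly_varying_def Let_def h_def)
  hence "eventually (\<lambda>x. dist (deriv h x) \<kappa> < 1) at_top" by (rule tendstoD) simp
  then obtain b0 where b0: "\<And>x. x \<ge> b0 \<Longrightarrow> dist (deriv h x) \<kappa> < 1"
    by (auto simp: eventually_at_top_linorder)
  define b where "b = max b0 (max a 0)"
  have h': "(h has_field_derivative deriv h x) (at x within {b<..})" if "x \<in> {b<..}" for x
  proof -
    from that have x: "x > a" "x > 0" by (auto simp: b_def)
    have "exp x > a" using x exp_ge_add_one_self[of x] by linarith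
    from a[OF this] obtain D where D: "(\<phi> has_real_derivative D) (at (exp x))"
      by (auto simp: real_differentiable_def)
    have "exp x \<ge> 1" using x by simp
    hence "exp x \<ge> ln 2" using ln2_le_25_over_36 by linarith
    hence "\<phi> (exp x) > 0" by (rule pos)
    moreover have "((\<lambda>x. \<phi> (exp x)) has_real_derivative D * exp x) (at x)"
      by (rule DERIV_chain2[where f = \<phi> and g = exp, OF D DERIV_exp])
    ultimately have "(h has_real_derivative (D * exp x) / \<phi> (exp x)) (at x)"
      unfolding h_def by (auto intro!: derivative_eq_intros)
    hence "h differentiable (at x)" by (auto simp: real_differentiable_def)
    thus ?thesis
      by (simp add: DERIV_deriv_iff_real_differentiable has_field_derivative_at_within)
  qed
  have bound: "norm (deriv h x) \<le> \<bar>\<kappa>\<bar> + 1" if "x \<in> {b<..}" for x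
    using b0[of x] that by (auto simp: dist_real_def b_def)
  have "\<bar>ln (\<phi> s1) - ln (\<phi> s2)\<bar> \<le> (\<bar>\<kappa>\<bar> + 1) * \<bar>ln s1 - ln s2\<bar>"
    if s: "s1 > exp b" "s2 > exp b" for s1 s2
  proof -
    have p: "s1 > 0" "s2 > 0" using s exp_gt_zero less_trans by blast+
    hence "ln s1 > b" "ln s2 > b" using s by (metis exp_less_cancel_iff exp_ln)+
    with field_differentiable_bound[OF convex_real_interval(3) h' bound, of "ln s1" "ln s2"]
    show ?thesis using p by (simp add: h_def)
  qed
  thus ?thesis by blast
qed

text \<open>
  This is what makes it possible to evaluate \<open>\<phi>\<close> at \<open>ln (V k)\<close> instead of \<open>\<rho> t * ln (\<rho> t)\<close>: the Lipschitz
  bound turns a ratio of arguments that tends to 1 into a ratio of values that tends to 1.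
\<close>

lemma tendsto_ratio:
  assumes s1: "filterlim s1 at_top F" and s2: "filterlim s2 at_top F"
    and r: "((\<lambda>x. s1 x / s2 x) \<longlongrightarrow> 1) F"
  shows "((\<lambda>x. \<phi> (s1 x) / \<phi> (s2 x)) \<longlongrightarrow> 1) F"
proof -
  obtain K S where KS: "\<And>s1 s2. s1 > S \<Longrightarrow> s2 > S \<Longrightarrow> \<bar>ln (\<phi> s1) - ln (\<phi> s2)\<bar> \<le> K * \<bar>ln s1 - ln s2\<bar>"
    using log_lipschitz by blast
  define S' where "S' = max S 1"
  have large: "eventually (\<lambda>x. s1 x > S' \<and> s2 x > S') F"
    using s1 s2 by (auto simp: filterlim_at_top_dense intro: eventually_conj)
  have lim: "((\<lambda>x. K * \<bar>ln (s1 x / s2 x)\<bar>) \<longlongrightarrow> K * \<bar>ln 1\<bar>) F"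
    by (intro tendsto_intros r) simp
  have "((\<lambda>x. ln (\<phi> (s1 x)) - ln (\<phi> (s2 x))) \<longlongrightarrow> 0) F"
  proof (rule Lim_null_comparison)
    show "eventually (\<lambda>x. norm (ln (\<phi> (s1 x)) - ln (\<phi> (s2 x))) \<le> K * \<bar>ln (s1 x / s2 x)\<bar>) F"
      using large by eventually_elim (use KS in \<open>auto simp: S'_def ln_div\<close>)
  qed (use lim in simp)
  from tendsto_exp[OF this]
  have "((\<lambda>x. exp (ln (\<phi> (s1 x)) - ln (\<phi> (s2 x)))) \<longlongrightarrow> 1) F" by simp
  moreover have "eventually (\<lambda>x. exp (ln (\<phi> (s1 x)) - ln (\<phi> (s2 x))) = \<phi> (s1 x) / \<phi> (s2 x)) F"
    using large
  proof eventually_elim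
    case (elim x)
    hence "s1 x \<ge> ln 2" "s2 x \<ge> ln 2" using ln2_le_25_over_36 by (auto simp: S'_def)
    thus ?case using pos[of "s1 x"] pos[of "s2 x"] by (simp add: exp_diff)
  qed
  ultimately show ?thesis by (rule Lim_transform_eventually)
qed

text \<open>
  By the Lipschitz bound \<open>ln (\<phi> s)\<close> grows at most like \<open>ln s\<close>.
\<close>

lemma log_sublinear: "((\<lambda>s. ln (\<phi> s) / s) \<longlongrightarrow> 0) at_top"
proof -
  obtain K S where KS: "\<And>s1 s2. s1 > S \<Longrightarrow> s2 > S \<Longrightarrow> \<bar>ln (\<phi> s1) - ln (\<phi> s2)\<bar> \<le> K * \<bar>ln s1 - ln s2\<bar>"
    using log_lipschitz by blast
  define c where "c = max S 1 + 1"
  define M where "M = \<bar>ln (\<phi> c)\<bar>"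
  show ?thesis
  proof (rule Lim_null_comparison)
    show "eventually (\<lambda>s. norm (ln (\<phi> s) / s) \<le> (M + K * \<bar>ln s - ln c\<bar>) / s) at_top"
      using eventually_gt_at_top[of "max S 0"]
    proof eventually_elim
      case (elim s)
      have "\<bar>ln (\<phi> s) - ln (\<phi> c)\<bar> \<le> K * \<bar>ln s - ln c\<bar>" using elim by (intro KS) (auto simp: c_def)
      hence "\<bar>ln (\<phi> s)\<bar> \<le> M + K * \<bar>ln s - ln c\<bar>" by (simp add: M_def)
      thus ?case using elim by (simp add: divide_right_mono)
    qed
    show "((\<lambda>s. (M + K * \<bar>ln s - ln c\<bar>) / s) \<longlongrightarrow> 0) at_top" by real_asymp
  qed
qed

end

section \<open>Logarithms of factorials\<close>

lemma ln_fact_upper: "ln (fact n :: real) \<le> real n * ln (real n)"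
proof (cases "n = 0")
  case False
  have "(fact n :: real) \<le> real (n ^ n)" by (rule fact_le_power)
  hence "ln (fact n :: real) \<le> ln (real n ^ n)" using False by (subst ln_le_cancel_iff) auto
  thus ?thesis using False by (simp add: ln_realpow)
qed simp

text \<open>
  Keep a single term of the exponential series of \<open>exp n\<close>: \<open>n ^ n / fact n \<le> exp n\<close>.
\<close>

lemma ln_fact_lower: "real n * ln (real n) - real n \<le> ln (fact n :: real)"
proof (cases "n = 0")
  case False
  have "real n ^ n / fact n \<le> exp (real n)"
  proof -
    have "(\<Sum>k\<in>{n}. real n ^ k /\<^sub>R fact k) \<le> exp (real n)"
      unfolding exp_def by (intro sum_le_suminf summable_exp_generic) auto
    thus ?thesis by (simp add: divide_inverse mult.commute)
  qed
  hence "real n ^ n \<le> exp (real n) * fact n" by (simp add: divide_simps)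
  hence "ln (real n ^ n) \<le> ln (exp (real n) * fact n)" using False by (subst ln_le_cancel_iff) auto
  thus ?thesis using False by (simp add: ln_realpow ln_mult)
qed simp

definition log_vol :: "nat \<Rightarrow> real" where
  "log_vol k = ln (V k)"

lemma log_vol_asymp: "(\<lambda>k. log_vol k / (real k * ln (real k))) \<longlonglongrightarrow> 1"
proof (rule tendsto_sandwich)
  show "eventually (\<lambda>k. (real (k + 1) * ln (real (k + 1)) - real (k + 1)) / (real k * ln (real k))
          \<le> log_vol k / (real k * ln (real k))) sequentially"
    using eventually_gt_at_top[of 1]
    by eventually_elim (unfold log_vol_def V_def, intro divide_right_mono ln_fact_lower, auto)
  show "eventually (\<lambda>k. log_vol k / (real k * ln (real k)) \<le>
          real (k + 1) * ln (real (k + 1)) / (real k * ln (real k))) sequentially"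
    using eventually_gt_at_top[of 1]
    by eventually_elim (unfold log_vol_def V_def, intro divide_right_mono ln_fact_upper, auto)
qed real_asymp+

lemma log_vol_at_top: "filterlim log_vol at_top sequentially"
proof -
  have "filterlim (\<lambda>k. log_vol k / (real k * ln (real k)) * (real k * ln (real k))) at_top sequentially"
    by (rule filterlim_tendsto_pos_mult_at_top[OF log_vol_asymp]) (simp, real_asymp)
  thus ?thesis
    by (rule filterlim_cong[THEN iffD1, OF refl refl, rotated])
       (rule eventually_mono[OF eventually_gt_at_top[of 1]], simp)
qed

lemma log_vol_pred_asymp: "(\<lambda>k. log_vol (k - 1) / (real k * ln (real k))) \<longlonglongrightarrow> 1"
proof (rule LIMSEQ_imp_Suc)
  have "(\<lambda>k. log_vol k / (real k * ln (real k)) *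
            (real k * ln (real k) / (real (Suc k) * ln (real (Suc k))))) \<longlonglongrightarrow> 1 * 1"
    by (rule tendsto_mult[OF log_vol_asymp]) real_asymp
  hence "(\<lambda>k. log_vol k / (real k * ln (real k)) *
            (real k * ln (real k) / (real (Suc k) * ln (real (Suc k))))) \<longlonglongrightarrow> 1" by simp
  thus "(\<lambda>k. log_vol (Suc k - 1) / (real (Suc k) * ln (real (Suc k)))) \<longlonglongrightarrow> 1"
    by (rule Lim_transform_eventually)
       (rule eventually_mono[OF eventually_gt_at_top[of 1]], simp)
qed

lemma log_vol_ratio: "(\<lambda>k. log_vol (k - 1) / log_vol k) \<longlonglongrightarrow> 1"
proof -
  have "(\<lambda>k. (log_vol (k - 1) / (real k * ln (real k))) / (log_vol k / (real k * ln (real k)))) \<longlonglongrightarrow> 1 / 1"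
    by (intro tendsto_divide log_vol_pred_asymp log_vol_asymp) simp
  hence "(\<lambda>k. (log_vol (k - 1) / (real k * ln (real k))) / (log_vol k / (real k * ln (real k)))) \<longlonglongrightarrow> 1"
    by simp
  thus ?thesis
    by (rule Lim_transform_eventually)
       (rule eventually_mono[OF eventually_gt_at_top[of 1]], simp)
qed

lemma log_vol_pred_at_top: "filterlim (\<lambda>k. log_vol (k - 1)) at_top sequentially"
  by (rule filterlim_compose[OF log_vol_at_top]) (rule filterlim_minus_const_nat_at_top)

section \<open>Two elementary estimates\<close>

text \<open>
  The maximum is attained at \<open>x = m\<close>; the inequality is \<open>ln y \<le> y - 1\<close> at \<open>y = x / m\<close>. It bounds the peak
  of a single term, for \<open>m = 1 / \<alpha>\<close>, and, for \<open>m = 2 / \<alpha>\<close>, trades an exponential for a power.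
\<close>

lemma powr_mult_exp_minus_le:
  fixes x m :: real
  assumes "x > 0" "m > 0"
  shows "x powr m * exp (- x) \<le> (m / exp 1) powr m"
proof -
  have "ln (x / m) \<le> x / m - 1" using ln_le_minus_one[of "x / m"] assms by simp
  hence "m * ln (x / m) \<le> m * (x / m - 1)" using assms by (intro mult_left_mono) auto
  hence "m * ln x - x \<le> m * (ln m - 1)" using assms by (simp add: ln_div algebra_simps)
  hence "exp (m * ln x - x) \<le> exp (m * (ln m - 1))" by simp
  moreover have "x powr m * exp (- x) = exp (m * ln x - x)"
    using assms by (simp add: powr_def exp_diff exp_minus divide_inverse)
  moreover have "(m / exp 1) powr m = exp (m * (ln m - 1))"
    using assms by (simp add: powr_def ln_div)
  ultimately show ?thesis by simp
qed

text \<open>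
  Beyond the point from which on the sequence doubles, the sum of all its previous terms is controlled by
  the current one, exactly as for a geometric progression.
\<close>

lemma sum_le_last_of_doubling:
  fixes b :: "nat \<Rightarrow> real"
  assumes pos: "\<And>n. n \<ge> 1 \<Longrightarrow> b n > 0"
    and dbl: "eventually (\<lambda>n. 2 * b n \<le> b (Suc n)) sequentially"
  shows "\<exists>M>0. eventually (\<lambda>n. (\<Sum>i=1..n. b i) \<le> M * b n) sequentially"
proof -
  from dbl obtain n1 where "\<And>n. n \<ge> n1 \<Longrightarrow> 2 * b n \<le> b (Suc n)"
    by (auto simp: eventually_sequentially)
  then obtain n0 where n0: "n0 \<ge> 1" "\<And>n. n \<ge> n0 \<Longrightarrow> 2 * b n \<le> b (Suc n)"
    by (metis max.bounded_iff max.cobounded1 le_refl)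
  define M where "M = max 2 ((\<Sum>i=1..n0. b i) / b n0)"
  have "(\<Sum>i=1..n. b i) \<le> M * b n" if "n \<ge> n0" for n
    using that
  proof (induction n rule: dec_induct)
    case base
    have "(\<Sum>i=1..n0. b i) / b n0 \<le> M" by (simp add: M_def)
    thus ?case using pos[OF n0(1)] by (simp add: divide_simps)
  next
    case (step n)
    have "(\<Sum>i=1..Suc n. b i) \<le> M * b n + b (Suc n)" using step by simp
    also have "M * b n \<le> M * (b (Suc n) / 2)"
      using n0(2)[OF step(1)] by (intro mult_left_mono) (auto simp: M_def)
    also have "M * (b (Suc n) / 2) + b (Suc n) \<le> M * b (Suc n)"
    proof -
      have "M \<ge> 2" by (simp add: M_def)
      hence "(M / 2 + 1) * b (Suc n) \<le> M * b (Suc n)"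
        using pos[of "Suc n"] by (intro mult_right_mono) auto
      thus ?thesis by (simp add: algebra_simps)
    qed
    finally show ?case by simp
  qed
  moreover have "M > 0" by (simp add: M_def)
  ultimately show ?thesis unfolding eventually_sequentially by blast
qed

section \<open>Upper and lower limits of quotients\<close>

lemma Limsup_filter_mono:
  fixes f :: "'a \<Rightarrow> 'b :: complete_linorder"
  assumes "F \<le> G"
  shows "Limsup F f \<le> Limsup G f"
  unfolding Limsup_le_iff using Limsup_lessD filter_leD[OF assms] by blast

lemma Liminf_filter_mono:
  fixes f :: "'a \<Rightarrow> 'b :: complete_linorder"
  assumes "F \<le> G"
  shows "Liminf G f \<le> Liminf F f"
  unfolding le_Liminf_iff using less_LiminfD filter_leD[OF assms] by blast

lemma Limsup_compose_le:
  fixes f :: "'a \<Rightarrow> 'b :: complete_linorder"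
  assumes "filterlim g G F"
  shows "Limsup F (\<lambda>x. f (g x)) \<le> Limsup G f"
proof -
  have "Limsup F (\<lambda>x. f (g x)) \<le> Limsup (filtermap g F) f" by (rule Limsup_filtermap_ge)
  also have "\<dots> \<le> Limsup G f"
    using assms by (intro Limsup_filter_mono) (simp add: filterlim_def)
  finally show ?thesis .
qed

lemma Liminf_compose_ge:
  fixes f :: "'a \<Rightarrow> 'b :: complete_linorder"
  assumes "filterlim g G F"
  shows "Liminf G f \<le> Liminf F (\<lambda>x. f (g x))"
proof -
  have "Liminf G f \<le> Liminf (filtermap g F) f"
    using assms by (intro Liminf_filter_mono) (simp add: filterlim_def)
  also have "\<dots> \<le> Liminf F (\<lambda>x. f (g x))" by (rule Liminf_filtermap_le)
  finally show ?thesis .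
qed

text \<open>
  The quotient \<open>P / Q\<close> is studied through common factors: \<open>\<tau>\<close> is the rescaling and \<open>G\<close> an explicit
  function of the level to which \<open>\<tau> * Q\<close> is asymptotic.
\<close>

lemma Limsup_ratio_normalised:
  fixes P Q \<tau> G W :: "'a \<Rightarrow> real"
  assumes F: "F \<noteq> bot" and Q: "((\<lambda>x. \<tau> x * Q x / G x) \<longlongrightarrow> 1) F"
    and pos: "eventually (\<lambda>x. \<tau> x > 0 \<and> G x > 0) F"
    and le: "eventually (\<lambda>x. \<tau> x * P x \<le> G x * W x) F" and W: "(W \<longlongrightarrow> l) F"
  shows "Limsup F (\<lambda>x. ereal (P x / Q x)) \<le> ereal l"
proof -
  have "((\<lambda>x. W x / (\<tau> x * Q x / G x)) \<longlongrightarrow> l / 1) F" by (intro tendsto_divide W Q) simp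
  hence lim: "((\<lambda>x. ereal (W x / (\<tau> x * Q x / G x))) \<longlongrightarrow> ereal l) F" by simp
  have "eventually (\<lambda>x. \<tau> x * Q x / G x > 0) F" using order_tendstoD(1)[OF Q] by simp
  hence "eventually (\<lambda>x. ereal (P x / Q x) \<le> ereal (W x / (\<tau> x * Q x / G x))) F"
    using pos le
  proof eventually_elim
    case (elim x)
    have "P x / Q x = \<tau> x * P x / (\<tau> x * Q x)" using elim by simp
    also have "\<dots> \<le> G x * W x / (\<tau> x * Q x)"
      using elim by (intro divide_right_mono) (auto simp: zero_less_divide_iff)
    also have "\<dots> = W x / (\<tau> x * Q x / G x)" by simp
    finally show ?case by simp
  qed
  hence "Limsup F (\<lambda>x. ereal (P x / Q x)) \<le> Limsup F (\<lambda>x. ereal (W x / (\<tau> x * Q x / G x)))"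
    by (rule Limsup_mono)
  also have "\<dots> = ereal l" by (rule lim_imp_Limsup[OF F lim])
  finally show ?thesis .
qed

lemma Liminf_ratio_normalised:
  fixes P Q \<tau> G W :: "'a \<Rightarrow> real"
  assumes F: "F \<noteq> bot" and Q: "((\<lambda>x. \<tau> x * Q x / G x) \<longlongrightarrow> 1) F"
    and pos: "eventually (\<lambda>x. \<tau> x > 0 \<and> G x > 0) F"
    and ge: "eventually (\<lambda>x. G x * W x \<le> \<tau> x * P x) F" and W: "(W \<longlongrightarrow> l) F"
  shows "ereal l \<le> Liminf F (\<lambda>x. ereal (P x / Q x))"
proof -
  have "Limsup F (\<lambda>x. ereal (- P x / Q x)) \<le> ereal (- l)"
    using ge by (intro Limsup_ratio_normalised[OF F Q pos, of _ "\<lambda>x. - W x"] tendsto_minus W) simp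
  hence "- Liminf F (\<lambda>x. ereal (P x / Q x)) \<le> - ereal l"
    by (simp add: ereal_Limsup_uminus[symmetric])
  thus ?thesis by (simp only: ereal_minus_le_minus)
qed

section \<open>The spectrum and the basic bounds\<close>

lemma V_ge_2: "k \<ge> 1 \<Longrightarrow> V k \<ge> 2"
  using V_growth[of "k" 0] self_le_power[of "2::real" k] by (simp add: V_def)

lemma log_vol_ge: "k \<ge> 1 \<Longrightarrow> log_vol k \<ge> ln 2"
  using V_ge_2[of k] by (simp add: log_vol_def)

locale symmetric_group_spectrum = smoothly_varying_function \<phi> \<kappa> for \<phi> \<kappa> +
  fixes \<alpha> :: real
  assumes \<alpha>_pos: "\<alpha> > 0"
    and strict_dec: "strict_antimono_on {2..} (Lambda \<alpha> \<phi>)"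
begin

abbreviation lam :: "nat \<Rightarrow> real" where
  "lam \<equiv> eigenval (Lambda \<alpha> \<phi>)"

text \<open>
  Chosen such that \<open>t powr (1 / \<alpha>) / V k\<close> is a function of \<open>t * lam k\<close> alone, up to a factor that does not
  depend on \<open>t\<close> and hardly on \<open>k\<close>.
\<close>

definition phi_factor :: "nat \<Rightarrow> real" where
  "phi_factor k = \<phi> (log_vol k) powr (- 1 / \<alpha>)"

lemma phi_log_vol_pos: "k \<ge> 1 \<Longrightarrow> \<phi> (log_vol k) > 0"
  by (intro pos log_vol_ge)

lemma phi_factor_pos: "k \<ge> 1 \<Longrightarrow> phi_factor k > 0"
  using phi_log_vol_pos[of k] by (simp add: phi_factor_def)

lemma lam_eq: "lam k = V k powr (- \<alpha>) * \<phi> (log_vol k)"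
  by (simp add: eigenval_def Lambda_def log_vol_def)

lemma lam_pos: "k \<ge> 1 \<Longrightarrow> lam k > 0"
  using phi_log_vol_pos[of k] by (simp add: lam_eq)

lemma ln_lam: "k \<ge> 1 \<Longrightarrow> ln (lam k) = - \<alpha> * log_vol k + ln (\<phi> (log_vol k))"
  using phi_log_vol_pos[of k] by (simp add: lam_eq ln_mult ln_powr log_vol_def)

lemma log_phi_log_vol: "(\<lambda>k. ln (\<phi> (log_vol k)) / log_vol k) \<longlonglongrightarrow> 0"
  by (rule filterlim_compose[OF log_sublinear log_vol_at_top])

lemma ln_lam_over_log_vol: "(\<lambda>k. - ln (lam k) / log_vol k) \<longlonglongrightarrow> \<alpha>"
proof -
  have "(\<lambda>k. \<alpha> - ln (\<phi> (log_vol k)) / log_vol k) \<longlonglongrightarrow> \<alpha> - 0"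
    by (intro tendsto_intros log_phi_log_vol)
  hence "(\<lambda>k. \<alpha> - ln (\<phi> (log_vol k)) / log_vol k) \<longlonglongrightarrow> \<alpha>" by simp
  moreover have "eventually (\<lambda>k. \<alpha> - ln (\<phi> (log_vol k)) / log_vol k = - ln (lam k) / log_vol k) sequentially"
    using eventually_ge_at_top[of 1]
  proof eventually_elim
    case (elim k)
    have "log_vol k > 0" using log_vol_ge[OF elim] ln_gt_zero[of "2::real"] by linarith
    thus ?case using elim by (simp add: ln_lam field_simps)
  qed
  ultimately show ?thesis by (rule Lim_transform_eventually)
qed

text \<open>
  \<open>- ln (lam k)\<close> is asymptotic to \<open>\<alpha> * log_vol k\<close>, since \<open>ln (\<phi> s)\<close> is negligible compared with \<open>s\<close>.
\<close>

lemma lam_tendsto_0: "lam \<longlonglongrightarrow> 0"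
proof -
  have "filterlim (\<lambda>k. - ln (lam k) / log_vol k * log_vol k) at_top sequentially"
    by (rule filterlim_tendsto_pos_mult_at_top[OF ln_lam_over_log_vol \<alpha>_pos log_vol_at_top])
  hence "filterlim (\<lambda>k. - (- ln (lam k) / log_vol k * log_vol k)) at_bot sequentially"
    by (simp only: filterlim_uminus_at_top)
  hence "(\<lambda>k. exp (- (- ln (lam k) / log_vol k * log_vol k))) \<longlonglongrightarrow> 0"
    by (rule filterlim_compose[OF exp_at_bot])
  moreover have "eventually (\<lambda>k. exp (- (- ln (lam k) / log_vol k * log_vol k)) = lam k) sequentially"
    using eventually_ge_at_top[of 1]
  proof eventually_elim
    case (elim k)
    have "log_vol k > 0" using log_vol_ge[OF elim] ln_gt_zero[of "2::real"] by linarith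
    thus ?case using lam_pos[OF elim] by simp
  qed
  ultimately show ?thesis by (rule Lim_transform_eventually)
qed

sublocale decreasing_spectrum "Lambda \<alpha> \<phi>"
proof
  fix k :: nat assume "k \<ge> 1"
  hence "V k \<in> {2..}" "V (Suc k) \<in> {2..}" using V_ge_2 by auto
  moreover have "V k < V (Suc k)" by (simp add: V_Suc)
  ultimately show "lam (Suc k) \<le> lam k"
    using monotone_onD[OF strict_dec, of "V k" "V (Suc k)"] by (simp add: eigenval_def)
qed (rule lam_tendsto_0)

lemma powr_div_V:
  assumes "t > 0" "k \<ge> 1"
  shows "t powr (1 / \<alpha>) / V k = (t * lam k) powr (1 / \<alpha>) * phi_factor k"
proof -
  have "(t * lam k) powr (1 / \<alpha>) =
        t powr (1 / \<alpha>) * (V k powr (- 1) * \<phi> (log_vol k) powr (1 / \<alpha>))"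
    using assms phi_log_vol_pos[OF assms(2)] \<alpha>_pos by (simp add: lam_eq powr_mult powr_powr)
  moreover have "\<phi> (log_vol k) powr (1 / \<alpha>) * phi_factor k = 1"
    using phi_log_vol_pos[OF assms(2)] by (simp add: phi_factor_def flip: powr_add)
  ultimately show ?thesis by (simp add: powr_minus_divide)
qed

lemma phi_factor_ratio: "(\<lambda>k. phi_factor (k - 1) / phi_factor k) \<longlonglongrightarrow> 1"
proof -
  have "(\<lambda>k. \<phi> (log_vol (k - 1)) / \<phi> (log_vol k)) \<longlonglongrightarrow> 1"
    by (rule tendsto_ratio[OF log_vol_pred_at_top log_vol_at_top log_vol_ratio])
  hence "(\<lambda>k. (\<phi> (log_vol (k - 1)) / \<phi> (log_vol k)) powr (- 1 / \<alpha>)) \<longlonglongrightarrow> 1 powr (- 1 / \<alpha>)"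
    by (intro tendsto_powr tendsto_const) auto
  hence "(\<lambda>k. (\<phi> (log_vol (k - 1)) / \<phi> (log_vol k)) powr (- 1 / \<alpha>)) \<longlonglongrightarrow> 1" by simp
  thus ?thesis
  proof (rule Lim_transform_eventually)
    show "eventually (\<lambda>k. (\<phi> (log_vol (k - 1)) / \<phi> (log_vol k)) powr (- 1 / \<alpha>) = phi_factor (k - 1) / phi_factor k) sequentially"
      using eventually_ge_at_top[of 2]
    proof eventually_elim
      case (elim k)
      have "\<phi> (log_vol (k - 1)) > 0" "\<phi> (log_vol k) > 0"
        using elim by (auto intro!: phi_log_vol_pos)
      thus ?case by (simp add: phi_factor_def powr_divide)
    qed
  qed
qed

abbreviation p :: "real \<Rightarrow> real" where
  "p \<equiv> diag_kernel (Lambda \<alpha> \<phi>)"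

lemma V_diff: "1 / V k - 1 / V (Suc k) = real (Suc k) / V (Suc k)"
proof -
  have "1 / V k = (real k + 2) / V (Suc k)" by (simp add: V_Suc)
  thus ?thesis by (simp add: diff_divide_distrib[symmetric])
qed

lemma diag_kernel_alt: "p t = (\<Sum>k. exp (- t * lam (Suc k)) * (real (Suc k) / V (Suc k)))"
  by (simp only: diag_kernel_def V_diff)

lemma summable_diag_kernel:
  assumes "t \<ge> 0"
  shows "summable (\<lambda>k. exp (- t * lam (Suc k)) * (real (Suc k) / V (Suc k)))"
proof -
  have "\<bar>exp (- t * lam (Suc k))\<bar> \<le> 1" for k
    using assms eigenval_nonneg[of k] by simp
  from summable_synth[of "\<lambda>k. exp (- t * lam (Suc k))" 1 1, OF this] show ?thesis by (simp only: layer_one V_diff)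
qed

text \<open>
  All terms of the series are positive; the bound keeps only the one with the eigenvalue \<open>lam j\<close>.
\<close>

lemma diag_kernel_lower:
  assumes "t > 0" "j \<ge> 1"
  shows "(t * lam j) powr (1 / \<alpha>) * exp (- (t * lam j)) * real j * phi_factor j \<le> t powr (1 / \<alpha>) * p t"
proof -
  have "(\<Sum>k\<in>{j - 1}. exp (- t * lam (Suc k)) * (real (Suc k) / V (Suc k))) \<le> p t"
    unfolding diag_kernel_alt using assms by (intro sum_le_suminf summable_diag_kernel) auto
  hence "t powr (1 / \<alpha>) * (exp (- (t * lam j)) * (real j / V j)) \<le> t powr (1 / \<alpha>) * p t"
    using assms by (intro mult_left_mono) auto
  also have "t powr (1 / \<alpha>) * (exp (- (t * lam j)) * (real j / V j)) =
             t powr (1 / \<alpha>) / V j * exp (- (t * lam j)) * real j" by simp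
  finally show ?thesis unfolding powr_div_V[OF assms] by (simp add: mult_ac)
qed

text \<open>
  Beyond level \<open>j\<close> the exponentials are replaced by 1, and the remaining series telescopes to \<open>1 / V j\<close>.
\<close>

lemma diag_kernel_le_split:
  assumes "t > 0" "j \<ge> 1"
  shows "p t \<le> (\<Sum>i=1..j - 1. exp (- t * lam i) * (real i / V i)) +
               exp (- t * lam j) * (real j / V j) + 1 / V j"
proof -
  let ?f = "\<lambda>k. exp (- t * lam (Suc k)) * (real (Suc k) / V (Suc k))"
  have s: "summable ?f" using assms by (intro summable_diag_kernel) simp
  have "p t = (\<Sum>n. ?f (n + j)) + (\<Sum>n<j. ?f n)"
    unfolding diag_kernel_alt by (rule suminf_split_initial_segment[OF s])
  also have "(\<Sum>n<j. ?f n) = (\<Sum>n<j - 1. ?f n) + ?f (j - 1)"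
    using assms(2) by (cases j) auto
  also have "(\<Sum>n<j - 1. ?f n) = (\<Sum>i=1..j - 1. exp (- t * lam i) * (real i / V i))"
    by (rule sum.reindex_bij_witness[of _ "\<lambda>i. i - 1" Suc]) auto
  also have "?f (j - 1) = exp (- t * lam j) * (real j / V j)" using assms(2) by simp
  also have "(\<Sum>n. ?f (n + j)) \<le> 1 / V j"
  proof -
    have "(\<lambda>n. 1 / V (n + j)) \<longlonglongrightarrow> 0"
      using LIMSEQ_ignore_initial_segment[OF inverse_V_tendsto_0] .
    from telescope_sums'[OF this]
    have tel: "(\<lambda>n. real (Suc (n + j)) / V (Suc (n + j))) sums (1 / V j)"
      unfolding add_Suc V_diff by (simp only: add_0 diff_zero)
    have "(\<Sum>n. ?f (n + j)) \<le> (\<Sum>n. real (Suc (n + j)) / V (Suc (n + j)))"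
    proof (rule suminf_le)
      fix n
      have "exp (- t * lam (Suc (n + j))) \<le> 1" using assms eigenval_nonneg[of "n + j"] by simp
      from mult_right_mono[OF this, of "real (Suc (n + j)) / V (Suc (n + j))"]
      show "?f (n + j) \<le> real (Suc (n + j)) / V (Suc (n + j))" by simp
    qed (rule summable_ignore_initial_segment[OF s], use tel in \<open>simp only: sums_iff\<close>)
    thus ?thesis using tel by (simp only: sums_iff)
  qed
  finally show ?thesis by simp
qed

text \<open>
  For the levels below \<open>j\<close>, \<open>exp (- x)\<close> is bounded by a multiple of \<open>x powr (- 2 / \<alpha>)\<close>. The exponent is
  chosen such that the resulting terms \<open>i * V i * (phi_factor i)\<^sup>2\<close> grow superexponentially in spite of the
  factor \<open>1 / V i\<close> in the series; so their sum is of the order of the last one, at \<open>i = j - 1\<close>. The other two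
  summands are the level \<open>j\<close> and everything beyond it. The constant \<open>M\<close> does not depend on \<open>t\<close>, so the
  level \<open>j\<close> may depend on \<open>t\<close>.
\<close>

lemma diag_kernel_upper:
  "\<exists>M>0. eventually (\<lambda>j. \<forall>t>0. t powr (1 / \<alpha>) * p t \<le>
       M * real (j - 1) * (t * lam (j - 1)) powr (- 1 / \<alpha>) * phi_factor (j - 1) +
       (t * lam j) powr (1 / \<alpha>) * exp (- (t * lam j)) * real j * phi_factor j +
       (t * lam j) powr (1 / \<alpha>) * phi_factor j) sequentially"
proof -
  define b where "b i = real i * V i * (phi_factor i)\<^sup>2" for i
  have b_pos: "b i > 0" if "i \<ge> 1" for i using that phi_factor_pos[OF that] by (simp add: b_def)
  have "eventually (\<lambda>n. 2 * b n \<le> b (Suc n)) sequentially"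
  proof -
    have "(\<lambda>n. phi_factor n / phi_factor (Suc n)) \<longlonglongrightarrow> 1" using LIMSEQ_Suc[OF phi_factor_ratio] by simp
    hence "eventually (\<lambda>n. phi_factor n / phi_factor (Suc n) < 2) sequentially" by (rule order_tendstoD) simp
    thus ?thesis using eventually_ge_at_top[of 6]
    proof eventually_elim
      case (elim n)
      have Bp: "phi_factor n > 0" "phi_factor (Suc n) > 0" using elim by (auto intro: phi_factor_pos)
      have "phi_factor n \<le> 2 * phi_factor (Suc n)" using elim(1) Bp by (simp add: divide_simps)
      hence "(phi_factor n)\<^sup>2 \<le> (2 * phi_factor (Suc n))\<^sup>2" using Bp by (intro power_mono) auto
      hence "2 * (real n * V n) * (phi_factor n)\<^sup>2 \<le> 2 * (real n * V n) * (4 * (phi_factor (Suc n))\<^sup>2)"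
        by (intro mult_left_mono) (auto simp: power_mult_distrib)
      also have "\<dots> = 8 * (real n * (V n * (phi_factor (Suc n))\<^sup>2))" by simp
      also have "\<dots> \<le> (real n + 2) * (real (Suc n) * (V n * (phi_factor (Suc n))\<^sup>2))"
        using elim(2) by (intro mult_mono mult_right_mono) auto
      also have "\<dots> = b (Suc n)" by (simp add: b_def V_Suc mult_ac)
      finally show ?case by (simp add: b_def mult_ac)
    qed
  qed
  from sum_le_last_of_doubling[of b, OF b_pos this] obtain M where M: "M > 0"
    "eventually (\<lambda>n. (\<Sum>i=1..n. b i) \<le> M * b n) sequentially" by blast
  define C where "C = (2 / \<alpha> / exp 1) powr (2 / \<alpha>)"
  have C: "C > 0" using \<alpha>_pos by (simp add: C_def)
  have "eventually (\<lambda>j. (\<Sum>i=1..j - 1. b i) \<le> M * b (j - 1)) sequentially"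
    using M(2) filterlim_minus_const_nat_at_top[of 1] by (rule eventually_compose_filterlim)
  moreover have "eventually (\<lambda>j::nat. j \<ge> 2) sequentially" by (rule eventually_ge_at_top)
  ultimately have "eventually (\<lambda>j. \<forall>t>0. t powr (1 / \<alpha>) * p t \<le>
       C * M * real (j - 1) * (t * lam (j - 1)) powr (- 1 / \<alpha>) * phi_factor (j - 1) +
       (t * lam j) powr (1 / \<alpha>) * exp (- (t * lam j)) * real j * phi_factor j +
       (t * lam j) powr (1 / \<alpha>) * phi_factor j) sequentially"
  proof eventually_elim
    case (elim j)
    show ?case
    proof (intro allI impI)
      fix t :: real assume t: "t > 0"
      define \<tau> where "\<tau> = t powr (1 / \<alpha>)"
      have \<tau>: "\<tau> > 0" using t by (simp add: \<tau>_def)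
      have small: "exp (- t * lam i) * (real i / V i) \<le> C / \<tau>\<^sup>2 * b i" if i: "i \<ge> 1" for i
      proof -
        define X where "X = (t * lam i) powr (1 / \<alpha>)"
        have x: "t * lam i > 0" using t lam_pos[OF i] by simp
        have "(t * lam i) powr (2 / \<alpha>) = X\<^sup>2"
          by (simp add: X_def power2_eq_square flip: powr_add)
        with powr_mult_exp_minus_le[OF x, of "2 / \<alpha>"] \<alpha>_pos
        have e: "X\<^sup>2 * exp (- (t * lam i)) \<le> C" by (simp add: C_def)
        have X: "X > 0" using t lam_pos[OF i] by (simp add: X_def)
        have "\<tau> / V i = X * phi_factor i" using powr_div_V[OF t i] by (simp add: X_def \<tau>_def)
        hence \<tau>eq: "\<tau> = V i * X * phi_factor i" by (simp add: field_simps)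
        have "exp (- (t * lam i)) \<le> C / X\<^sup>2" using e X by (simp add: pos_le_divide_eq mult.commute)
        hence "exp (- (t * lam i)) * (real i / V i) \<le> C / X\<^sup>2 * (real i / V i)"
          by (intro mult_right_mono) auto
        also have "\<dots> = C / \<tau>\<^sup>2 * b i"
          unfolding \<tau>eq b_def using X phi_factor_pos[OF i] by (simp add: power2_eq_square field_simps)
        finally show ?thesis by simp
      qed
      have "(\<Sum>i=1..j - 1. exp (- t * lam i) * (real i / V i)) \<le> (\<Sum>i=1..j - 1. C / \<tau>\<^sup>2 * b i)"
        by (intro sum_mono small) auto
      also have "\<dots> = C / \<tau>\<^sup>2 * (\<Sum>i=1..j - 1. b i)" by (rule sum_distrib_left[symmetric])
      also have "\<dots> \<le> C / \<tau>\<^sup>2 * (M * b (j - 1))" using elim(1) C by (intro mult_left_mono) auto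
      finally have "\<tau> * (\<Sum>i=1..j - 1. exp (- t * lam i) * (real i / V i)) \<le>
                    \<tau> * (C / \<tau>\<^sup>2 * (M * b (j - 1)))"
        using \<tau> by (intro mult_left_mono) auto
      also have "\<dots> = C * M * real (j - 1) * (t * lam (j - 1)) powr (- 1 / \<alpha>) * phi_factor (j - 1)"
      proof -
        define Y where "Y = (t * lam (j - 1)) powr (1 / \<alpha>)"
        have j1: "j - 1 \<ge> 1" using elim(2) by simp
        have Y: "Y > 0" using t lam_pos[OF j1] by (simp add: Y_def)
        have "\<tau> / V (j - 1) = Y * phi_factor (j - 1)" using powr_div_V[OF t j1] by (simp add: Y_def \<tau>_def)
        hence \<tau>eq: "\<tau> = V (j - 1) * Y * phi_factor (j - 1)" by (simp add: field_simps)
        have Y': "(t * lam (j - 1)) powr (- 1 / \<alpha>) = 1 / Y" by (simp add: Y_def powr_minus_divide)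
        show ?thesis unfolding Y' unfolding \<tau>eq b_def using Y phi_factor_pos[OF j1]
          by (simp add: power2_eq_square field_simps)
      qed
      finally have 1: "\<tau> * (\<Sum>i=1..j - 1. exp (- t * lam i) * (real i / V i)) \<le>
          C * M * real (j - 1) * (t * lam (j - 1)) powr (- 1 / \<alpha>) * phi_factor (j - 1)" .
      have j: "j \<ge> 1" using elim(2) by simp
      have eq: "\<tau> / V j = (t * lam j) powr (1 / \<alpha>) * phi_factor j" using powr_div_V[OF t j] by (simp add: \<tau>_def)
      have "\<tau> * p t \<le> \<tau> * ((\<Sum>i=1..j - 1. exp (- t * lam i) * (real i / V i)) +
               exp (- t * lam j) * (real j / V j) + 1 / V j)"
        using \<tau> by (intro mult_left_mono diag_kernel_le_split t j) auto
      also have "\<dots> = \<tau> * (\<Sum>i=1..j - 1. exp (- t * lam i) * (real i / V i)) +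
               \<tau> / V j * exp (- (t * lam j)) * real j + \<tau> / V j"
        by (simp add: algebra_simps)
      finally show "t powr (1 / \<alpha>) * p t \<le>
         C * M * real (j - 1) * (t * lam (j - 1)) powr (- 1 / \<alpha>) * phi_factor (j - 1) +
         (t * lam j) powr (1 / \<alpha>) * exp (- (t * lam j)) * real j * phi_factor j +
         (t * lam j) powr (1 / \<alpha>) * phi_factor j"
        using 1 unfolding eq by (simp add: \<tau>_def mult_ac)
    qed
  qed
  moreover have "C * M > 0" using C M(1) by simp
  ultimately show ?thesis by blast
qed

section \<open>The normalising functions along a sequence of levels\<close>

lemma ln_lam_asymp:
  "(\<lambda>k. - ln (lam k) / (real k * ln (real k))) \<longlonglongrightarrow> \<alpha>"
  "(\<lambda>k. - ln (lam (k - 1)) / (real k * ln (real k))) \<longlonglongrightarrow> \<alpha>"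
proof -
  have ne: "log_vol k \<noteq> 0" if "k \<ge> 1" for k
    using log_vol_ge[OF that] ln_gt_zero[of "2::real"] by linarith
  have "(\<lambda>k. (- ln (lam k) / log_vol k) * (log_vol k / (real k * ln (real k)))) \<longlonglongrightarrow> \<alpha> * 1"
    by (rule tendsto_mult[OF ln_lam_over_log_vol log_vol_asymp])
  hence "(\<lambda>k. (- ln (lam k) / log_vol k) * (log_vol k / (real k * ln (real k)))) \<longlonglongrightarrow> \<alpha>" by simp
  thus "(\<lambda>k. - ln (lam k) / (real k * ln (real k))) \<longlonglongrightarrow> \<alpha>"
    by (rule Lim_transform_eventually)
       (rule eventually_mono[OF eventually_ge_at_top[of 1]], use ne in simp)
  have "(\<lambda>k. - ln (lam (k - 1)) / log_vol (k - 1)) \<longlonglongrightarrow> \<alpha>"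
    by (rule filterlim_compose[OF ln_lam_over_log_vol]) (rule filterlim_minus_const_nat_at_top)
  from tendsto_mult[OF this log_vol_pred_asymp]
  have "(\<lambda>k. (- ln (lam (k - 1)) / log_vol (k - 1)) * (log_vol (k - 1) / (real k * ln (real k)))) \<longlonglongrightarrow> \<alpha>"
    by simp
  thus "(\<lambda>k. - ln (lam (k - 1)) / (real k * ln (real k))) \<longlonglongrightarrow> \<alpha>"
    by (rule Lim_transform_eventually)
       (rule eventually_mono[OF eventually_ge_at_top[of 2]], use ne in simp)
qed

text \<open>
  The bounds say that \<open>t\<close> lies between the inverse eigenvalues of the levels \<open>j - 1\<close> and \<open>j\<close>, up to factors
  whose logarithms do not matter; they are generous enough for both the peaks and the valleys. With
  \<open>k = real j\<close> one obtains in turn \<open>ln t \<sim> \<alpha> * k * ln k\<close>, \<open>ln (ln t) \<sim> ln k\<close>, \<open>\<rho> t \<sim> k\<close>, and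
  \<open>\<rho> t * ln (\<rho> t) \<sim> log_vol j\<close>. An arbitrary filter \<open>F\<close> covers real times with a level depending on them as
  well as sequences of times indexed by the level.
\<close>

lemma normalisation:
  fixes t :: "'a \<Rightarrow> real" and j :: "'a \<Rightarrow> nat"
  assumes j: "filterlim j at_top F" and c: "c > 0"
    and lower: "eventually (\<lambda>x. c \<le> t x * lam (j x - 1)) F"
    and upper: "eventually (\<lambda>x. t x * lam (j x) \<le> (ln (real (j x)))\<^sup>2) F"
  shows normalisation_at_top: "filterlim t at_top F"
    and normalisation_Psi: "((\<lambda>x. t x powr (1 / \<alpha>) * \<Psi> \<alpha> \<phi> (t x) /
          ((1 / (exp 1 * \<alpha>)) powr (1 / \<alpha>) * real (j x) * phi_factor (j x))) \<longlongrightarrow> 1) F"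
    and normalisation_psi: "((\<lambda>x. t x powr (1 / \<alpha>) * \<psi> \<alpha> \<phi> (t x) /
          (ln (real (j x)) powr (1 / \<alpha>) * phi_factor (j x))) \<longlongrightarrow> 1) F"
proof -
  define k where "k x = real (j x)" for x
  define u where "u x = ln (t x) / (k x * ln (k x))" for x
  define r where "r x = \<rho> \<alpha> (t x)" for x
  define R where "R x = \<phi> (r x * ln (r x)) / \<phi> (log_vol (j x))" for x
  have k: "filterlim k at_top F"
    unfolding k_def by (rule filterlim_compose[OF filterlim_real_sequentially j])
  have lnk: "filterlim (\<lambda>x. ln (k x)) at_top F" by (rule filterlim_compose[OF ln_at_top k])
  have lnk0: "((\<lambda>x. 1 / ln (k x)) \<longlongrightarrow> 0) F"
    by (rule tendsto_divide_0[OF tendsto_const filterlim_at_top_imp_at_infinity[OF lnk]])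
  have kbig: "eventually (\<lambda>x. k x > exp 1 \<and> ln (k x) > 1 \<and> j x \<ge> 2) F"
  proof -
    have "eventually (\<lambda>x. k x > exp 1) F" "eventually (\<lambda>x. ln (k x) > 1) F"
      using k lnk by (auto simp: filterlim_at_top_dense)
    moreover have "eventually (\<lambda>x. j x \<ge> 2) F" using j by (auto simp: filterlim_at_top)
    ultimately show ?thesis by (intro eventually_conj)
  qed
  have tpos: "eventually (\<lambda>x. t x > 0) F"
    using lower kbig
  proof eventually_elim
    case (elim x)
    have "lam (j x - 1) > 0" using elim by (intro lam_pos) auto
    moreover have "t x * lam (j x - 1) > 0" using elim c by linarith
    ultimately show ?case by (simp add: zero_less_mult_iff)
  qed
  \<comment> \<open>Taking logarithms, both bounds on \<open>t\<close> give the same leading term.\<close>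
  have u: "(u \<longlongrightarrow> \<alpha>) F"
  proof (rule tendsto_sandwich)
    have c1: "(\<lambda>n::nat. ln c / (real n * ln (real n))) \<longlonglongrightarrow> 0" by real_asymp
    have "(\<lambda>n. ln c / (real n * ln (real n)) + - ln (lam (n - 1)) / (real n * ln (real n))) \<longlonglongrightarrow> 0 + \<alpha>"
      by (intro tendsto_add c1 ln_lam_asymp)
    from filterlim_compose[OF this j]
    show "((\<lambda>x. ln c / (k x * ln (k x)) + - ln (lam (j x - 1)) / (k x * ln (k x))) \<longlongrightarrow> \<alpha>) F"
      by (simp add: k_def)
    have c2: "(\<lambda>n::nat. ln ((ln (real n))\<^sup>2) / (real n * ln (real n))) \<longlonglongrightarrow> 0" by real_asymp
    have "(\<lambda>n. ln ((ln (real n))\<^sup>2) / (real n * ln (real n)) + - ln (lam n) / (real n * ln (real n))) \<longlonglongrightarrow> 0 + \<alpha>"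
      by (intro tendsto_add c2 ln_lam_asymp)
    from filterlim_compose[OF this j]
    show "((\<lambda>x. ln ((ln (k x))\<^sup>2) / (k x * ln (k x)) + - ln (lam (j x)) / (k x * ln (k x))) \<longlongrightarrow> \<alpha>) F"
      by (simp add: k_def)
    show "eventually (\<lambda>x. ln c / (k x * ln (k x)) + - ln (lam (j x - 1)) / (k x * ln (k x)) \<le> u x) F"
      using lower kbig tpos
    proof eventually_elim
      case (elim x)
      have l: "lam (j x - 1) > 0" using elim by (intro lam_pos) auto
      have "ln c \<le> ln (t x * lam (j x - 1))" using elim c by (subst ln_le_cancel_iff) auto
      also have "\<dots> = ln (t x) + ln (lam (j x - 1))" using elim l by (simp add: ln_mult)
      finally have "ln c + - ln (lam (j x - 1)) \<le> ln (t x)" by simp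
      hence "(ln c + - ln (lam (j x - 1))) / (k x * ln (k x)) \<le> ln (t x) / (k x * ln (k x))"
        using elim by (intro divide_right_mono) (auto simp: k_def)
      thus ?case by (simp add: u_def add_divide_distrib diff_divide_distrib)
    qed
    show "eventually (\<lambda>x. u x \<le> ln ((ln (k x))\<^sup>2) / (k x * ln (k x)) + - ln (lam (j x)) / (k x * ln (k x))) F"
      using upper kbig tpos
    proof eventually_elim
      case (elim x)
      have l: "lam (j x) > 0" using elim by (intro lam_pos) auto
      have "ln (t x) + ln (lam (j x)) = ln (t x * lam (j x))" using elim l by (simp add: ln_mult)
      also have "\<dots> \<le> ln ((ln (k x))\<^sup>2)"
        using elim l by (subst ln_le_cancel_iff) (auto simp: k_def)
      finally have "ln (t x) \<le> ln ((ln (k x))\<^sup>2) + - ln (lam (j x))" by simp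
      hence "ln (t x) / (k x * ln (k x)) \<le> (ln ((ln (k x))\<^sup>2) + - ln (lam (j x))) / (k x * ln (k x))"
        using elim by (intro divide_right_mono) (auto simp: k_def)
      thus ?case by (simp only: u_def add_divide_distrib)
    qed
  qed
  have upos: "eventually (\<lambda>x. u x > 0) F" using order_tendstoD(1)[OF u \<alpha>_pos] .
  have klnk: "filterlim (\<lambda>x. k x * ln (k x)) at_top F" by (rule filterlim_at_top_mult_at_top[OF k lnk])
  have "filterlim (\<lambda>x. u x * (k x * ln (k x))) at_top F"
    by (rule filterlim_tendsto_pos_mult_at_top[OF u \<alpha>_pos klnk])
  moreover have eq: "eventually (\<lambda>x. u x * (k x * ln (k x)) = ln (t x)) F"
    using kbig by eventually_elim (auto simp: u_def k_def)
  ultimately have lnt: "filterlim (\<lambda>x. ln (t x)) at_top F"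
    by (simp only: filterlim_cong[OF refl refl eq])
  have "filterlim (\<lambda>x. exp (ln (t x))) at_top F" by (rule filterlim_compose[OF exp_at_top lnt])
  moreover have "eventually (\<lambda>x. exp (ln (t x)) = t x) F" using tpos by eventually_elim simp
  ultimately show t_top: "filterlim t at_top F" by (simp only: filterlim_cong[OF refl refl])
  have lntpos: "eventually (\<lambda>x. ln (t x) > 1) F" using lnt by (auto simp: filterlim_at_top_dense)
  have lnln: "((\<lambda>x. ln (ln (t x)) / ln (k x)) \<longlongrightarrow> 1) F"
  proof -
    have "((\<lambda>x. ln (u x) * (1 / ln (k x)) + 1 + ln (ln (k x)) / ln (k x)) \<longlongrightarrow> ln \<alpha> * 0 + 1 + 0) F"
    proof (intro tendsto_add tendsto_mult tendsto_ln u lnk0 tendsto_const)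
      have "((\<lambda>y::real. ln y / y) \<longlongrightarrow> 0) at_top" by real_asymp
      from filterlim_compose[OF this lnk] show "((\<lambda>x. ln (ln (k x)) / ln (k x)) \<longlongrightarrow> 0) F" .
    qed (use \<alpha>_pos in auto)
    hence "((\<lambda>x. ln (u x) * (1 / ln (k x)) + 1 + ln (ln (k x)) / ln (k x)) \<longlongrightarrow> 1) F" by simp
    moreover have "eventually (\<lambda>x. ln (u x) * (1 / ln (k x)) + 1 + ln (ln (k x)) / ln (k x) =
                      ln (ln (t x)) / ln (k x)) F"
      using kbig upos eq
    proof eventually_elim
      case (elim x)
      have "k x > 0" using elim exp_gt_zero[of "1::real"] by linarith
      hence "ln (ln (t x)) = ln (u x) + (ln (k x) + ln (ln (k x)))"
        unfolding elim(3)[symmetric] using elim(1,2) by (auto simp: ln_mult)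
      thus ?case using elim by (simp add: add_divide_distrib)
    qed
    ultimately show ?thesis by (rule Lim_transform_eventually)
  qed
  \<comment> \<open>The definition of \<open>\<rho>\<close> inverts \<open>ln t \<sim> \<alpha> * k * ln k\<close>, because \<open>ln (ln t) \<sim> ln k\<close>.\<close>
  have rk: "((\<lambda>x. r x / k x) \<longlongrightarrow> 1) F"
  proof -
    have "((\<lambda>x. u x / \<alpha> / (ln (ln (t x)) / ln (k x))) \<longlongrightarrow> \<alpha> / \<alpha> / 1) F"
      using \<alpha>_pos by (intro tendsto_divide u lnln tendsto_const) auto
    hence "((\<lambda>x. u x / \<alpha> / (ln (ln (t x)) / ln (k x))) \<longlongrightarrow> 1) F" using \<alpha>_pos by simp
    moreover have "eventually (\<lambda>x. u x / \<alpha> / (ln (ln (t x)) / ln (k x)) = r x / k x) F"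
      using kbig by eventually_elim (auto simp: u_def r_def \<rho>_def k_def)
    ultimately show ?thesis by (rule Lim_transform_eventually)
  qed
  have rkpos: "eventually (\<lambda>x. r x / k x > 0) F" using order_tendstoD(1)[OF rk] by simp
  have rpos: "eventually (\<lambda>x. r x > 0) F"
    using rkpos kbig by eventually_elim (auto simp: zero_less_divide_iff k_def)
  have lnr: "((\<lambda>x. ln (r x) / ln (k x)) \<longlongrightarrow> 1) F"
  proof -
    have "((\<lambda>x. ln (r x / k x) * (1 / ln (k x)) + 1) \<longlongrightarrow> ln 1 * 0 + 1) F"
      by (intro tendsto_add tendsto_mult tendsto_ln rk lnk0 tendsto_const) auto
    hence "((\<lambda>x. ln (r x / k x) * (1 / ln (k x)) + 1) \<longlongrightarrow> 1) F" by simp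
    moreover have "eventually (\<lambda>x. ln (r x / k x) * (1 / ln (k x)) + 1 = ln (r x) / ln (k x)) F"
      using kbig rpos
    proof eventually_elim
      case (elim x)
      have "k x > 0" using elim exp_gt_zero[of "1::real"] by linarith
      thus ?case using elim by (auto simp: ln_div diff_divide_distrib)
    qed
    ultimately show ?thesis by (rule Lim_transform_eventually)
  qed
  have lv: "((\<lambda>x. log_vol (j x) / (k x * ln (k x))) \<longlongrightarrow> 1) F"
    unfolding k_def by (rule filterlim_compose[OF log_vol_asymp j])
  have lv_top: "filterlim (\<lambda>x. log_vol (j x)) at_top F" by (rule filterlim_compose[OF log_vol_at_top j])
  have arg: "((\<lambda>x. (r x * ln (r x)) / log_vol (j x)) \<longlongrightarrow> 1) F"
  proof -
    have "((\<lambda>x. (r x / k x) * (ln (r x) / ln (k x)) / (log_vol (j x) / (k x * ln (k x)))) \<longlongrightarrow> 1 * 1 / 1) F"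
      by (intro tendsto_divide tendsto_mult rk lnr lv) auto
    hence "((\<lambda>x. (r x / k x) * (ln (r x) / ln (k x)) / (log_vol (j x) / (k x * ln (k x)))) \<longlongrightarrow> 1) F"
      by simp
    moreover have "eventually (\<lambda>x. (r x / k x) * (ln (r x) / ln (k x)) / (log_vol (j x) / (k x * ln (k x))) =
                      (r x * ln (r x)) / log_vol (j x)) F"
      using kbig by eventually_elim (auto simp: k_def)
    ultimately show ?thesis by (rule Lim_transform_eventually)
  qed
  have arg_top: "filterlim (\<lambda>x. r x * ln (r x)) at_top F"
  proof -
    have "filterlim (\<lambda>x. (r x * ln (r x)) / log_vol (j x) * log_vol (j x)) at_top F"
      by (rule filterlim_tendsto_pos_mult_at_top[OF arg _ lv_top]) simp
    moreover have "eventually (\<lambda>x. (r x * ln (r x)) / log_vol (j x) * log_vol (j x) = r x * ln (r x)) F"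
    proof -
      have "eventually (\<lambda>x. log_vol (j x) > 0) F" using lv_top by (auto simp: filterlim_at_top_dense)
      thus ?thesis by eventually_elim simp
    qed
    ultimately show ?thesis by (simp only: filterlim_cong[OF refl refl])
  qed
  have R: "(R \<longlongrightarrow> 1) F" unfolding R_def by (rule tendsto_ratio[OF arg_top lv_top arg])
  have good: "eventually (\<lambda>x. \<phi> (r x * ln (r x)) > 0 \<and> \<phi> (log_vol (j x)) > 0 \<and> ln (r x) > 0
                \<and> r x > 0 \<and> k x > 0 \<and> ln (k x) > 0 \<and> t x > 0) F"
  proof -
    have "eventually (\<lambda>x. r x * ln (r x) > ln 2) F" using arg_top by (auto simp: filterlim_at_top_dense)
    moreover have "eventually (\<lambda>x. ln (r x) / ln (k x) > 0) F" using order_tendstoD(1)[OF lnr] by simp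
    ultimately show ?thesis using kbig rpos tpos
    proof eventually_elim
      case (elim x)
      have "k x > 0" using elim exp_gt_zero[of "1::real"] by linarith
      moreover have "\<phi> (r x * ln (r x)) > 0" using elim by (intro pos) auto
      moreover have "\<phi> (log_vol (j x)) > 0" using elim by (intro phi_log_vol_pos) auto
      moreover have "ln (r x) > 0" using elim by (auto simp: zero_less_divide_iff)
      moreover have "ln (k x) > 0" using elim by linarith
      ultimately show ?case using elim by blast
    qed
  qed
  have Rp: "((\<lambda>x. R x powr (- 1 / \<alpha>)) \<longlongrightarrow> 1) F"
    using tendsto_powr[OF R tendsto_const[of "- 1 / \<alpha>"]] by simp
  show "((\<lambda>x. t x powr (1 / \<alpha>) * \<Psi> \<alpha> \<phi> (t x) /
          ((1 / (exp 1 * \<alpha>)) powr (1 / \<alpha>) * real (j x) * phi_factor (j x))) \<longlongrightarrow> 1) F"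
  proof -
    have "((\<lambda>x. (r x / k x) * R x powr (- 1 / \<alpha>)) \<longlongrightarrow> 1) F"
      using tendsto_mult[OF rk Rp] by simp
    moreover have "eventually (\<lambda>x. (r x / k x) * R x powr (- 1 / \<alpha>) =
        t x powr (1 / \<alpha>) * \<Psi> \<alpha> \<phi> (t x) /
          ((1 / (exp 1 * \<alpha>)) powr (1 / \<alpha>) * real (j x) * phi_factor (j x))) F"
      using good
    proof eventually_elim
      case (elim x)
      define E where "E = exp (1::real) * \<alpha>"
      have E: "E > 0" using \<alpha>_pos by (simp add: E_def)
      have "\<Psi> \<alpha> \<phi> (t x) = t x powr (- 1 / \<alpha>) *
              (r x * (1 / E) powr (1 / \<alpha>) * \<phi> (r x * ln (r x)) powr (- 1 / \<alpha>))"
        using elim E \<alpha>_pos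
        by (simp add: \<Psi>_def r_def[symmetric] E_def[symmetric] powr_divide powr_mult powr_powr powr_minus_divide)
      hence 1: "t x powr (1 / \<alpha>) * \<Psi> \<alpha> \<phi> (t x) =
              r x * (1 / E) powr (1 / \<alpha>) * \<phi> (r x * ln (r x)) powr (- 1 / \<alpha>)"
        using elim by (simp add: powr_minus_divide)
      have 2: "R x powr (- 1 / \<alpha>) = \<phi> (r x * ln (r x)) powr (- 1 / \<alpha>) / phi_factor (j x)"
        using elim by (simp add: R_def phi_factor_def powr_divide)
      have "(1 / E) powr (1 / \<alpha>) > 0" using E by simp
      thus ?case unfolding 1 2 E_def[symmetric] k_def[symmetric] by (simp add: field_simps)
    qed
    ultimately show ?thesis by (rule Lim_transform_eventually)
  qed
  show "((\<lambda>x. t x powr (1 / \<alpha>) * \<psi> \<alpha> \<phi> (t x) /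
          (ln (real (j x)) powr (1 / \<alpha>) * phi_factor (j x))) \<longlongrightarrow> 1) F"
  proof -
    have "((\<lambda>x. (ln (r x) / ln (k x)) powr (1 / \<alpha>) * R x powr (- 1 / \<alpha>)) \<longlongrightarrow> 1) F"
      using tendsto_mult[OF tendsto_powr[OF lnr tendsto_const[of "1 / \<alpha>"]] Rp] by simp
    moreover have "eventually (\<lambda>x. (ln (r x) / ln (k x)) powr (1 / \<alpha>) * R x powr (- 1 / \<alpha>) =
        t x powr (1 / \<alpha>) * \<psi> \<alpha> \<phi> (t x) / (ln (real (j x)) powr (1 / \<alpha>) * phi_factor (j x))) F"
      using good
    proof eventually_elim
      case (elim x)
      have "\<psi> \<alpha> \<phi> (t x) = t x powr (- 1 / \<alpha>) *
              (ln (r x) powr (1 / \<alpha>) * \<phi> (r x * ln (r x)) powr (- 1 / \<alpha>))"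
        using elim by (simp add: \<psi>_def r_def[symmetric] powr_divide powr_minus_divide)
      hence 1: "t x powr (1 / \<alpha>) * \<psi> \<alpha> \<phi> (t x) =
              ln (r x) powr (1 / \<alpha>) * \<phi> (r x * ln (r x)) powr (- 1 / \<alpha>)"
        using elim by (simp add: powr_minus_divide)
      have 2: "R x powr (- 1 / \<alpha>) = \<phi> (r x * ln (r x)) powr (- 1 / \<alpha>) / phi_factor (j x)"
        using elim by (simp add: R_def phi_factor_def powr_divide)
      have 3: "(ln (r x) / ln (k x)) powr (1 / \<alpha>) = ln (r x) powr (1 / \<alpha>) / ln (k x) powr (1 / \<alpha>)"
        using elim by (simp add: powr_divide)
      show ?case unfolding 1 2 3 k_def[symmetric] by simp
    qed
    ultimately show ?thesis by (rule Lim_transform_eventually)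
  qed
qed

section \<open>Peaks and valleys of the rescaled kernel\<close>

text \<open>
  The level at which \<open>t * lam k\<close> falls below the threshold \<open>D k\<close> for the first time. A level that
  stays fixed is eventually left behind, because \<open>t * lam k\<close> grows with \<open>t\<close>.
\<close>

lemma crossing_level:
  fixes D :: "nat \<Rightarrow> real"
  assumes d: "d > 0" and D: "eventually (\<lambda>k. d \<le> D k) sequentially"
  shows "\<exists>j :: real \<Rightarrow> nat. filterlim j at_top at_top \<and>
           eventually (\<lambda>t. t * lam (j t) < D (j t)) at_top \<and>
           eventually (\<lambda>t. D (j t - 1) \<le> t * lam (j t - 1)) at_top"
proof -
  define j where "j t = (LEAST k. k \<ge> 1 \<and> t * lam k < D k)" for t
  have j: "j t \<ge> 1 \<and> t * lam (j t) < D (j t)" for t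
    unfolding j_def
  proof (rule LeastI_ex)
    have "(\<lambda>k. t * lam k) \<longlonglongrightarrow> t * 0" by (intro tendsto_intros lam_tendsto_0)
    hence "eventually (\<lambda>k. t * lam k < d) sequentially" using d by (intro order_tendstoD) auto
    hence "eventually (\<lambda>k. k \<ge> 1 \<and> t * lam k < D k) sequentially"
      using D eventually_ge_at_top[of 1] by eventually_elim auto
    thus "\<exists>k. k \<ge> 1 \<and> t * lam k < D k" by (auto simp: eventually_sequentially)
  qed
  have before: "D k \<le> t * lam k" if "k \<ge> 1" "k < j t" for k t
    using not_less_Least[of k "\<lambda>k. k \<ge> 1 \<and> t * lam k < D k"] that unfolding j_def by auto
  have top: "filterlim j at_top at_top"
    unfolding filterlim_at_top
  proof
    fix Z :: nat
    have "eventually (\<lambda>t. \<forall>k\<in>{1..<Z}. D k \<le> t * lam k) at_top"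
    proof (rule eventually_ball_finite)
      show "\<forall>k\<in>{1..<Z}. eventually (\<lambda>t. D k \<le> t * lam k) at_top"
      proof
        fix k assume "k \<in> {1..<Z}"
        hence "lam k > 0" by (intro lam_pos) auto
        thus "eventually (\<lambda>t. D k \<le> t * lam k) at_top"
          by (intro eventually_mono[OF eventually_ge_at_top[of "D k / lam k"]]) (simp add: divide_simps)
      qed
    qed simp
    thus "eventually (\<lambda>t. Z \<le> j t) at_top"
    proof eventually_elim
      case (elim t)
      show "Z \<le> j t"
      proof (rule ccontr)
        assume "\<not> Z \<le> j t"
        hence "D (j t) \<le> t * lam (j t)" using elim j[of t] by auto
        thus False using j[of t] by simp
      qed
    qed
  qed
  moreover have "eventually (\<lambda>t. D (j t - 1) \<le> t * lam (j t - 1)) at_top"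
  proof -
    have "eventually (\<lambda>t. j t \<ge> 2) at_top" using top by (auto simp: filterlim_at_top)
    thus ?thesis by eventually_elim (intro before, auto)
  qed
  ultimately show ?thesis using j by auto
qed

lemma level_shift:
  assumes "t > 0" "k \<ge> 2"
  shows "(t * lam (k - 1)) powr (1 / \<alpha>) * phi_factor (k - 1) =
         (real k + 1) * ((t * lam k) powr (1 / \<alpha>) * phi_factor k)"
proof -
  have "V k = (real k + 1) * V (k - 1)" using V_Suc[of "k - 1"] assms(2) by (simp add: of_nat_diff)
  hence "t powr (1 / \<alpha>) / V (k - 1) = (real k + 1) * (t powr (1 / \<alpha>) / V k)" by simp
  thus ?thesis using powr_div_V[of t "k - 1"] powr_div_V[of t k] assms by simp
qed

text \<open>
  The maximum of \<open>x powr (1 / \<alpha>) * exp (- x)\<close>, attained at \<open>x = 1 / \<alpha>\<close>; it accounts for the constant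
  \<open>exp 1 * \<alpha>\<close> in \<open>\<Psi>\<close>.
\<close>

definition peak :: real where
  "peak = (1 / (exp 1 * \<alpha>)) powr (1 / \<alpha>)"

lemma peak_pos: "peak > 0"
  using \<alpha>_pos by (simp add: peak_def)

lemma peak_bound: "x > 0 \<Longrightarrow> x powr (1 / \<alpha>) * exp (- x) \<le> peak"
  using powr_mult_exp_minus_le[of x "1 / \<alpha>"] \<alpha>_pos by (simp add: peak_def mult.commute)

lemma peak_eq: "peak = (1 / \<alpha>) powr (1 / \<alpha>) * exp (- (1 / \<alpha>))"
proof -
  have "peak = (1 / \<alpha>) powr (1 / \<alpha>) * (1 / exp 1) powr (1 / \<alpha>)"
    unfolding peak_def using \<alpha>_pos by (subst powr_mult[symmetric]) (auto simp: mult.commute)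
  also have "(1 / exp 1 :: real) powr (1 / \<alpha>) = exp (- (1 / \<alpha>))" by (simp add: powr_def ln_div)
  finally show ?thesis .
qed

text \<open>
  With a large constant threshold \<open>D\<close>, the levels before the crossing level contribute a share of order
  \<open>D powr (- 1 / \<alpha>)\<close>, the crossing level at most \<open>peak\<close>, and the levels beyond it a share that is smaller by
  a factor of order \<open>j\<close>. Finally \<open>D\<close> tends to infinity.
\<close>

lemma Limsup_le_1: "Limsup at_top (\<lambda>t. ereal (p t / \<Psi> \<alpha> \<phi> t)) \<le> 1"
proof -
  obtain M where M: "M > 0" and up: "eventually (\<lambda>j. \<forall>t>0. t powr (1 / \<alpha>) * p t \<le>
       M * real (j - 1) * (t * lam (j - 1)) powr (- 1 / \<alpha>) * phi_factor (j - 1) +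
       (t * lam j) powr (1 / \<alpha>) * exp (- (t * lam j)) * real j * phi_factor j +
       (t * lam j) powr (1 / \<alpha>) * phi_factor j) sequentially"
    using diag_kernel_upper by blast
  have bound: "Limsup at_top (\<lambda>t. ereal (p t / \<Psi> \<alpha> \<phi> t)) \<le> ereal (M / peak * D powr (- 1 / \<alpha>) + 1)"
    if D: "D > 0" for D
  proof -
    obtain j :: "real \<Rightarrow> nat" where j: "filterlim j at_top at_top"
      and j1: "eventually (\<lambda>t. t * lam (j t) < D) at_top"
      and j2: "eventually (\<lambda>t. D \<le> t * lam (j t - 1)) at_top"
      using crossing_level[OF D, of "\<lambda>_. D"] by auto
    have jbig: "eventually (\<lambda>t. D \<le> (ln (real (j t)))\<^sup>2 \<and> j t \<ge> 2) at_top"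
    proof -
      have "filterlim (\<lambda>n::nat. (ln (real n))\<^sup>2) at_top sequentially" by real_asymp
      from filterlim_compose[OF this j] have "eventually (\<lambda>t. D \<le> (ln (real (j t)))\<^sup>2) at_top"
        by (auto simp: filterlim_at_top)
      moreover have "eventually (\<lambda>t. j t \<ge> 2) at_top" using j by (auto simp: filterlim_at_top)
      ultimately show ?thesis by (rule eventually_conj)
    qed
    have up2: "eventually (\<lambda>t. t * lam (j t) \<le> (ln (real (j t)))\<^sup>2) at_top"
      using j1 jbig by eventually_elim auto
    note Q = normalisation_Psi[OF j D j2 up2, folded peak_def]
    define W where "W k = M / peak * D powr (- 1 / \<alpha>) * (phi_factor (k - 1) / phi_factor k) + 1 +
                          D powr (1 / \<alpha>) / peak * (1 / real k)" for k
    have "W \<longlonglongrightarrow> M / peak * D powr (- 1 / \<alpha>) * 1 + 1 + D powr (1 / \<alpha>) / peak * 0"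
      unfolding W_def by (intro tendsto_add tendsto_mult tendsto_const phi_factor_ratio lim_1_over_n)
    hence W: "((\<lambda>t. W (j t)) \<longlongrightarrow> M / peak * D powr (- 1 / \<alpha>) + 1) at_top"
      using filterlim_compose[OF _ j] by simp
    show ?thesis
    proof (rule Limsup_ratio_normalised[OF _ Q _ _ W])
      show "eventually (\<lambda>t. t powr (1 / \<alpha>) > 0 \<and> peak * real (j t) * phi_factor (j t) > 0) at_top"
        using eventually_gt_at_top[of 0] jbig
        by eventually_elim (use peak_pos in \<open>auto intro!: mult_pos_pos phi_factor_pos\<close>)
      show "eventually (\<lambda>t. t powr (1 / \<alpha>) * p t \<le> peak * real (j t) * phi_factor (j t) * W (j t)) at_top"
        using eventually_gt_at_top[of 0] jbig j1 j2 eventually_compose_filterlim[OF up j]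
      proof eventually_elim
        case (elim t)
        define k where "k = j t"
        have k: "k \<ge> 2" and t: "t > 0" using elim by (auto simp: k_def)
        have B: "phi_factor k > 0" "phi_factor (k - 1) > 0" using k by (auto intro: phi_factor_pos)
        have l: "lam k > 0" "lam (k - 1) > 0" using k by (auto intro: lam_pos)
        have 1: "(t * lam (k - 1)) powr (- 1 / \<alpha>) \<le> D powr (- 1 / \<alpha>)"
          using elim D \<alpha>_pos by (intro powr_mono2') (auto simp: k_def)
        have 2: "(t * lam k) powr (1 / \<alpha>) * exp (- (t * lam k)) \<le> peak"
          using t l by (intro peak_bound) simp
        have 3: "(t * lam k) powr (1 / \<alpha>) \<le> D powr (1 / \<alpha>)"
          using elim t l \<alpha>_pos by (intro powr_mono2) (auto simp: k_def)
        have "t powr (1 / \<alpha>) * p t \<le> M * real (k - 1) * (t * lam (k - 1)) powr (- 1 / \<alpha>) * phi_factor (k - 1) +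
             (t * lam k) powr (1 / \<alpha>) * exp (- (t * lam k)) * real k * phi_factor k +
             (t * lam k) powr (1 / \<alpha>) * phi_factor k"
          using elim t by (auto simp: k_def)
        also have "\<dots> \<le> M * real k * D powr (- 1 / \<alpha>) * phi_factor (k - 1) + peak * real k * phi_factor k + D powr (1 / \<alpha>) * phi_factor k"
          using M B 1 2 3 peak_pos by (intro add_mono mult_mono) auto
        also have "\<dots> = peak * real k * phi_factor k * W k"
          using B k peak_pos by (simp add: W_def field_simps)
        finally show ?case by (simp add: k_def)
      qed
    qed simp
  qed
  have "(\<lambda>n. ereal (M / peak * real (Suc n) powr (- 1 / \<alpha>) + 1)) \<longlonglongrightarrow> ereal (M / peak * 0 + 1)"
  proof (intro tendsto_intros)
    show "(\<lambda>n. real (Suc n) powr (- 1 / \<alpha>)) \<longlonglongrightarrow> 0"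
      using \<alpha>_pos by (intro tendsto_neg_powr filterlim_compose[OF filterlim_real_sequentially filterlim_Suc]) auto
  qed
  hence "(\<lambda>n. ereal (M / peak * real (Suc n) powr (- 1 / \<alpha>) + 1)) \<longlonglongrightarrow> 1" by (simp add: one_ereal_def)
  thus ?thesis
  proof (rule tendsto_lowerbound)
    show "eventually (\<lambda>n. Limsup at_top (\<lambda>t. ereal (p t / \<Psi> \<alpha> \<phi> t)) \<le>
            ereal (M / peak * real (Suc n) powr (- 1 / \<alpha>) + 1)) sequentially"
      by (intro always_eventually allI bound) simp
  qed simp
qed

text \<open>
  Rounding \<open>A k / lam k\<close> up to an integer costs at most \<open>lam k\<close>, which tends to 0, so any prescribed size of
  \<open>t * lam k\<close> can be realised by integer times.
\<close>

lemma integer_times: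
  assumes A: "eventually (\<lambda>k. c \<le> A k) sequentially" and c: "c > 0"
  shows "\<exists>n :: nat \<Rightarrow> nat. eventually (\<lambda>k. A k \<le> real (n k) * lam k \<and> real (n k) * lam k \<le> A k + lam k) sequentially"
proof (intro exI)
  show "eventually (\<lambda>k. A k \<le> real (nat \<lceil>A k / lam k\<rceil>) * lam k \<and>
                        real (nat \<lceil>A k / lam k\<rceil>) * lam k \<le> A k + lam k) sequentially"
    using A eventually_ge_at_top[of 1]
  proof eventually_elim
    case (elim k)
    have l: "lam k > 0" by (rule lam_pos[OF elim(2)])
    define a where "a = A k / lam k"
    have a: "a > 0" "A k = a * lam k" using l c elim by (auto simp: a_def)
    have "a \<le> real (nat \<lceil>a\<rceil>)" by (rule of_nat_ceiling)
    moreover have "real (nat \<lceil>a\<rceil>) \<le> a + 1"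
    proof -
      have "real (nat \<lceil>a\<rceil>) = real_of_int \<lceil>a\<rceil>" using a by simp
      thus ?thesis by linarith
    qed
    ultimately have "a * lam k \<le> real (nat \<lceil>a\<rceil>) * lam k" "real (nat \<lceil>a\<rceil>) * lam k \<le> (a + 1) * lam k"
      using l by (auto intro: mult_right_mono)
    thus ?case using a unfolding a_def[symmetric] by (simp add: algebra_simps)
  qed
qed

lemma filterlim_nat_of_real:
  assumes "filterlim (\<lambda>x. real (n x)) at_top F"
  shows "filterlim n at_top F"
  unfolding filterlim_at_top
proof
  fix Z :: nat
  from assms have "eventually (\<lambda>x. real Z \<le> real (n x)) F" unfolding filterlim_at_top by blast
  thus "eventually (\<lambda>x. Z \<le> n x) F" by simp
qed

text \<open>
  At integer times with \<open>t * lam k\<close> close to \<open>1 / \<alpha>\<close> the term of level \<open>k\<close> alone reaches the peak.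
\<close>

lemma limsup_ge_1: "1 \<le> limsup (\<lambda>n. ereal (p (real n) / \<Psi> \<alpha> \<phi> (real n)))"
proof -
  have c: "1 / \<alpha> > 0" using \<alpha>_pos by simp
  obtain n :: "nat \<Rightarrow> nat" where n: "eventually (\<lambda>k. 1 / \<alpha> \<le> real (n k) * lam k \<and>
        real (n k) * lam k \<le> 1 / \<alpha> + lam k) sequentially"
    using integer_times[of "1 / \<alpha>" "\<lambda>_. 1 / \<alpha>"] c by auto
  define X where "X k = real (n k) * lam k" for k
  have lamX: "(\<lambda>k. 1 / \<alpha> + lam k) \<longlonglongrightarrow> 1 / \<alpha>" using tendsto_add[OF tendsto_const lam_tendsto_0] by simp
  have X: "X \<longlonglongrightarrow> 1 / \<alpha>"
    by (rule tendsto_sandwich[OF _ _ tendsto_const lamX]) (use n in \<open>auto simp: X_def elim: eventually_mono\<close>)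
  have j: "filterlim (\<lambda>k::nat. k) at_top sequentially" by (rule filterlim_ident)
  have lower: "eventually (\<lambda>k. 1 / \<alpha> \<le> real (n k) * lam (k - 1)) sequentially"
    using n eventually_ge_at_top[of 2]
  proof eventually_elim
    case (elim k)
    have "lam k \<le> lam (k - 1)" using eigenval_Suc_le[of "k - 1"] elim by simp
    hence "real (n k) * lam k \<le> real (n k) * lam (k - 1)" by (intro mult_left_mono) auto
    thus ?case using elim by linarith
  qed
  have upper: "eventually (\<lambda>k. real (n k) * lam k \<le> (ln (real k))\<^sup>2) sequentially"
  proof -
    have "eventually (\<lambda>k. X k < 1 / \<alpha> + 1) sequentially" using X by (rule order_tendstoD) simp
    moreover have "eventually (\<lambda>k::nat. 1 / \<alpha> + 1 \<le> (ln (real k))\<^sup>2) sequentially"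
    proof -
      have "filterlim (\<lambda>n::nat. (ln (real n))\<^sup>2) at_top sequentially" by real_asymp
      thus ?thesis by (auto simp: filterlim_at_top)
    qed
    ultimately show ?thesis by eventually_elim (simp add: X_def)
  qed
  note Q = normalisation_Psi[OF j c lower upper, folded peak_def]
  define W where "W k = X k powr (1 / \<alpha>) * exp (- X k) / peak" for k
  have "W \<longlonglongrightarrow> (1 / \<alpha>) powr (1 / \<alpha>) * exp (- (1 / \<alpha>)) / peak"
    unfolding W_def using \<alpha>_pos peak_pos by (intro tendsto_intros X) auto
  hence W: "W \<longlonglongrightarrow> 1" using peak_pos by (simp flip: peak_eq)
  have npos: "eventually (\<lambda>k. real (n k) > 0 \<and> k \<ge> 1) sequentially"
    using n eventually_ge_at_top[of 1]
  proof eventually_elim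
    case (elim k)
    hence "real (n k) * lam k > 0" using c by linarith
    thus ?case using elim by (cases "n k") auto
  qed
  have "ereal 1 \<le> liminf (\<lambda>k. ereal (p (real (n k)) / \<Psi> \<alpha> \<phi> (real (n k))))"
  proof (rule Liminf_ratio_normalised[OF _ Q _ _ W])
    show "eventually (\<lambda>k. real (n k) powr (1 / \<alpha>) > 0 \<and> peak * real k * phi_factor k > 0) sequentially"
      using npos by eventually_elim (use peak_pos in \<open>auto intro!: mult_pos_pos phi_factor_pos\<close>)
    show "eventually (\<lambda>k. peak * real k * phi_factor k * W k \<le> real (n k) powr (1 / \<alpha>) * p (real (n k))) sequentially"
      using npos
    proof eventually_elim
      case (elim k)
      have "peak * real k * phi_factor k * W k = X k powr (1 / \<alpha>) * exp (- X k) * real k * phi_factor k"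
        using peak_pos by (simp add: W_def)
      also have "\<dots> \<le> real (n k) powr (1 / \<alpha>) * p (real (n k))"
        unfolding X_def using elim by (intro diag_kernel_lower) auto
      finally show ?case .
    qed
  qed simp
  also have "\<dots> \<le> limsup (\<lambda>k. ereal (p (real (n k)) / \<Psi> \<alpha> \<phi> (real (n k))))"
    by (rule Liminf_le_Limsup) simp
  also have "\<dots> \<le> limsup (\<lambda>n. ereal (p (real n) / \<Psi> \<alpha> \<phi> (real n)))"
    by (rule Limsup_compose_le[OF filterlim_nat_of_real[OF normalisation_at_top[OF j c lower upper]]])
  finally show ?thesis by (simp add: one_ereal_def)
qed

text \<open>
  At integer times with \<open>t * lam k\<close> close to \<open>ln k + ln (ln k)\<close> the term of level \<open>k\<close> has become smaller, by
  a factor of order \<open>ln k\<close>, than the contribution \<open>(t * lam k) powr (1 / \<alpha>) * phi_factor k\<close> of all higher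
  levels, while \<open>t * lam k\<close> is still asymptotic to \<open>ln k\<close>. These times lie between the
  inverse eigenvalues of the levels \<open>k\<close> and \<open>Suc k\<close>, so \<open>\<psi>\<close> is compared with its value at level \<open>Suc k\<close>.
\<close>

lemma liminf_le_1: "liminf (\<lambda>n. ereal (p (real n) / \<psi> \<alpha> \<phi> (real n))) \<le> 1"
proof -
  obtain M where M: "M > 0" and up: "eventually (\<lambda>j. \<forall>t>0. t powr (1 / \<alpha>) * p t \<le>
       M * real (j - 1) * (t * lam (j - 1)) powr (- 1 / \<alpha>) * phi_factor (j - 1) +
       (t * lam j) powr (1 / \<alpha>) * exp (- (t * lam j)) * real j * phi_factor j +
       (t * lam j) powr (1 / \<alpha>) * phi_factor j) sequentially"
    using diag_kernel_upper by blast
  define A where "A k = ln (real k) + ln (ln (real k))" for k :: nat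
  have Atop: "filterlim A at_top sequentially" unfolding A_def by real_asymp
  have A1: "eventually (\<lambda>k. 1 \<le> A k) sequentially" using Atop by (auto simp: filterlim_at_top)
  obtain n :: "nat \<Rightarrow> nat" where n: "eventually (\<lambda>k. A k \<le> real (n k) * lam k \<and>
        real (n k) * lam k \<le> A k + lam k) sequentially"
    using integer_times[OF A1] by auto
  define X where "X k = real (n k) * lam k" for k
  have Xtop: "filterlim X at_top sequentially"
    by (rule filterlim_at_top_mono[OF Atop]) (use n in \<open>auto simp: X_def elim: eventually_mono\<close>)
  have Xlog: "(\<lambda>k. X k / ln (real (Suc k))) \<longlonglongrightarrow> 1"
  proof (rule tendsto_sandwich)
    show "(\<lambda>k. A k / ln (real (Suc k))) \<longlonglongrightarrow> 1" unfolding A_def by real_asymp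
    have "(\<lambda>k. A k / ln (real (Suc k)) + lam k * (1 / ln (real (Suc k)))) \<longlonglongrightarrow> 1 + 0 * 0"
    proof (intro tendsto_add tendsto_mult lam_tendsto_0)
      show "(\<lambda>k. A k / ln (real (Suc k))) \<longlonglongrightarrow> 1" unfolding A_def by real_asymp
      show "(\<lambda>k. 1 / ln (real (Suc k))) \<longlonglongrightarrow> 0" by real_asymp
    qed
    thus "(\<lambda>k. A k / ln (real (Suc k)) + lam k * (1 / ln (real (Suc k)))) \<longlonglongrightarrow> 1" by simp
    show "eventually (\<lambda>k. A k / ln (real (Suc k)) \<le> X k / ln (real (Suc k))) sequentially"
      using n by eventually_elim (auto simp: X_def intro!: divide_right_mono)
    show "eventually (\<lambda>k. X k / ln (real (Suc k)) \<le> A k / ln (real (Suc k)) + lam k * (1 / ln (real (Suc k)))) sequentially"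
      using n
    proof eventually_elim
      case (elim k)
      hence "X k / ln (real (Suc k)) \<le> (A k + lam k) / ln (real (Suc k))"
        by (intro divide_right_mono) (auto simp: X_def)
      thus ?case by (simp add: add_divide_distrib)
    qed
  qed
  have j: "filterlim Suc at_top sequentially" by (rule filterlim_Suc)
  have lower: "eventually (\<lambda>k. 1 \<le> real (n k) * lam (Suc k - 1)) sequentially"
    using n A1 by eventually_elim auto
  have upper: "eventually (\<lambda>k. real (n k) * lam (Suc k) \<le> (ln (real (Suc k)))\<^sup>2) sequentially"
  proof -
    have "eventually (\<lambda>k. X k / ln (real (Suc k)) < 2) sequentially"
      using Xlog by (rule order_tendstoD) simp
    moreover have "eventually (\<lambda>k. ln (real (Suc k)) \<ge> 2) sequentially"
    proof -
      have "filterlim (\<lambda>k. ln (real (Suc k))) at_top sequentially" by real_asymp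
      thus ?thesis by (auto simp: filterlim_at_top)
    qed
    ultimately show ?thesis using eventually_ge_at_top[of 1]
    proof eventually_elim
      case (elim k)
      have "real (n k) * lam (Suc k) \<le> X k"
        unfolding X_def using eigenval_Suc_le[OF elim(3)] by (intro mult_left_mono) auto
      also have "\<dots> \<le> 2 * ln (real (Suc k))" using elim by (simp add: divide_simps)
      also have "\<dots> \<le> ln (real (Suc k)) * ln (real (Suc k))" using elim by (intro mult_right_mono) auto
      finally show ?case by (simp add: power2_eq_square)
    qed
  qed
  note Q = normalisation_psi[OF j zero_less_one lower upper]
  define W where "W k = M * X k powr (- 1 / \<alpha>) * (phi_factor (k - 1) / phi_factor k)\<^sup>2 * (phi_factor k / phi_factor (Suc k)) *
        ln (real (Suc k)) powr (- 1 / \<alpha>) +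
        (X k / ln (real (Suc k))) powr (1 / \<alpha>) * (phi_factor k / phi_factor (Suc k)) * (1 / ln (real k) + 1)" for k
  have Bs: "(\<lambda>k. phi_factor k / phi_factor (Suc k)) \<longlonglongrightarrow> 1" using LIMSEQ_Suc[OF phi_factor_ratio] by simp
  have lnS: "filterlim (\<lambda>k. ln (real (Suc k))) at_top sequentially" by real_asymp
  have lnk: "(\<lambda>k::nat. 1 / ln (real k)) \<longlonglongrightarrow> 0" by real_asymp
  have "W \<longlonglongrightarrow> M * 0 * 1\<^sup>2 * 1 * 0 + 1 powr (1 / \<alpha>) * 1 * (0 + 1)"
    unfolding W_def using \<alpha>_pos
    by (intro tendsto_add tendsto_mult tendsto_power tendsto_const phi_factor_ratio Bs lnk
          tendsto_powr[OF Xlog] tendsto_neg_powr Xtop lnS) auto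
  hence W: "W \<longlonglongrightarrow> 1" by simp
  have big: "eventually (\<lambda>k. real (n k) > 0 \<and> k \<ge> 3 \<and> X k > 0 \<and> ln (real k) > 0) sequentially"
    using n A1 eventually_ge_at_top[of 3]
  proof eventually_elim
    case (elim k)
    have "X k > 0" using elim by (simp add: X_def)
    moreover have "n k \<noteq> 0"
    proof
      assume "n k = 0"
      with \<open>X k > 0\<close> show False by (simp add: X_def)
    qed
    ultimately show ?case using elim by auto
  qed
  have "limsup (\<lambda>k. ereal (p (real (n k)) / \<psi> \<alpha> \<phi> (real (n k)))) \<le> ereal 1"
  proof (rule Limsup_ratio_normalised[OF _ Q _ _ W])
    show "eventually (\<lambda>k. real (n k) powr (1 / \<alpha>) > 0 \<and>
            ln (real (Suc k)) powr (1 / \<alpha>) * phi_factor (Suc k) > 0) sequentially"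
      using big by eventually_elim (auto intro!: mult_pos_pos phi_factor_pos)
    show "eventually (\<lambda>k. real (n k) powr (1 / \<alpha>) * p (real (n k)) \<le>
            ln (real (Suc k)) powr (1 / \<alpha>) * phi_factor (Suc k) * W k) sequentially"
      using big up n
    proof eventually_elim
      case (elim k)
      define Y where "Y = X k powr (1 / \<alpha>)"
      have k: "k \<ge> 2" and t: "real (n k) > 0" using elim by auto
      have B: "phi_factor k > 0" "phi_factor (k - 1) > 0" "phi_factor (Suc k) > 0" using k by (auto intro: phi_factor_pos)
      have Y: "Y > 0" using elim by (simp add: Y_def)
      have L: "ln (real (Suc k)) > 0" using k by simp
      have l: "ln (real k) > 0" using elim by simp
      define Z where "Z = (real (n k) * lam (k - 1)) powr (1 / \<alpha>)"
      have Zeq: "Z * phi_factor (k - 1) = (real k + 1) * (Y * phi_factor k)"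
        using level_shift[OF t k] by (simp add: Z_def Y_def X_def)
      have Z: "Z > 0"
      proof -
        have "Z * phi_factor (k - 1) > 0" unfolding Zeq using Y B by simp
        thus ?thesis using B by (simp add: zero_less_mult_iff)
      qed
      have "M * real (k - 1) * (real (n k) * lam (k - 1)) powr (- 1 / \<alpha>) * phi_factor (k - 1) =
            M * real (k - 1) * (phi_factor (k - 1) * phi_factor (k - 1)) / (Z * phi_factor (k - 1))"
        using B Z by (simp add: Z_def powr_minus_divide)
      also have "\<dots> = real (k - 1) / (real k + 1) * (M * (phi_factor (k - 1) * phi_factor (k - 1)) / (Y * phi_factor k))"
        unfolding Zeq by simp
      also have "\<dots> \<le> 1 * (M * (phi_factor (k - 1) * phi_factor (k - 1)) / (Y * phi_factor k))"
        using M B Y k by (intro mult_right_mono) auto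
      finally have 1: "M * real (k - 1) * (real (n k) * lam (k - 1)) powr (- 1 / \<alpha>) * phi_factor (k - 1) \<le>
           M * (phi_factor (k - 1) * phi_factor (k - 1)) / (Y * phi_factor k)" by simp
      have "exp (- X k) \<le> exp (- A k)" using elim by (simp add: X_def)
      also have "exp (- A k) = 1 / (real k * ln (real k))"
        using k l by (simp add: A_def exp_minus exp_diff exp_add divide_inverse)
      finally have "exp (- X k) * real k \<le> 1 / (real k * ln (real k)) * real k"
        by (intro mult_right_mono) auto
      also have "\<dots> = 1 / ln (real k)" using k by simp
      finally have "Y * phi_factor k * (exp (- X k) * real k) \<le> Y * phi_factor k * (1 / ln (real k))"
        using Y B by (intro mult_left_mono) auto
      hence 2: "Y * exp (- X k) * real k * phi_factor k \<le> Y * phi_factor k * (1 / ln (real k))" by (simp add: mult_ac)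
      have "real (n k) powr (1 / \<alpha>) * p (real (n k)) \<le>
          M * real (k - 1) * (real (n k) * lam (k - 1)) powr (- 1 / \<alpha>) * phi_factor (k - 1) +
          Y * exp (- X k) * real k * phi_factor k + Y * phi_factor k"
        using elim t unfolding Y_def X_def by blast
      also have "\<dots> \<le> M * (phi_factor (k - 1) * phi_factor (k - 1)) / (Y * phi_factor k) + Y * phi_factor k * (1 / ln (real k)) + Y * phi_factor k"
        using 1 2 by simp
      also have "\<dots> = ln (real (Suc k)) powr (1 / \<alpha>) * phi_factor (Suc k) * W k"
      proof -
        define S where "S = ln (real (Suc k)) powr (1 / \<alpha>)"
        have S: "S > 0" using L by (simp add: S_def)
        have e1: "X k powr (- 1 / \<alpha>) = 1 / Y" by (simp add: Y_def powr_minus_divide)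
        have e2: "ln (real (Suc k)) powr (- 1 / \<alpha>) = 1 / S" by (simp add: S_def powr_minus_divide)
        have e3: "(X k / ln (real (Suc k))) powr (1 / \<alpha>) = Y / S"
          using L elim by (simp add: Y_def S_def powr_divide)
        show ?thesis unfolding W_def e1 e2 e3 S_def[symmetric] using S Y B l
          by (simp add: power2_eq_square field_simps)
      qed
      finally show ?case .
    qed
  qed simp
  hence "limsup (\<lambda>k. ereal (p (real (n k)) / \<psi> \<alpha> \<phi> (real (n k)))) \<le> 1" by (simp add: one_ereal_def)
  moreover have "liminf (\<lambda>n. ereal (p (real n) / \<psi> \<alpha> \<phi> (real n))) \<le>
                 liminf (\<lambda>k. ereal (p (real (n k)) / \<psi> \<alpha> \<phi> (real (n k))))"
    by (rule Liminf_compose_ge[OF filterlim_nat_of_real[OF normalisation_at_top[OF j zero_less_one lower upper]]])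
  moreover have "liminf (\<lambda>k. ereal (p (real (n k)) / \<psi> \<alpha> \<phi> (real (n k)))) \<le>
                 limsup (\<lambda>k. ereal (p (real (n k)) / \<psi> \<alpha> \<phi> (real (n k))))"
    by (rule Liminf_le_Limsup) simp
  ultimately show ?thesis by (meson order_trans)
qed

text \<open>
  For \<open>\<delta> < 1\<close> let \<open>j\<close> be the first level with \<open>t * lam j < \<delta> * ln j\<close> and put \<open>x = t * lam j\<close>. The term of level
  \<open>j\<close> suffices. If \<open>x\<close> is small, its exponential is close to 1, and the bound follows from the fact that the
  threshold has not been reached at level \<open>j - 1\<close>. If \<open>x\<close> is not small, \<open>exp (- x)\<close> is still at least
  \<open>j powr (- \<delta>)\<close>, and the term exceeds the bound by a power of \<open>j\<close>.
\<close>

lemma Liminf_ge_1: "1 \<le> Liminf at_top (\<lambda>t. ereal (p t / \<psi> \<alpha> \<phi> t))"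
proof -
  have bound: "ereal (\<delta> powr (1 / \<alpha>)) \<le> Liminf at_top (\<lambda>t. ereal (p t / \<psi> \<alpha> \<phi> t))"
    if \<delta>: "\<delta> > 0" "\<delta> < 1" for \<delta>
  proof -
    have ln_top: "filterlim (\<lambda>n::nat. ln (real n)) at_top sequentially" by real_asymp
    have "eventually (\<lambda>n::nat. 1 \<le> ln (real n)) sequentially"
      using ln_top by (auto simp: filterlim_at_top)
    hence ev: "eventually (\<lambda>n::nat. \<delta> \<le> \<delta> * ln (real n)) sequentially"
      by eventually_elim (use \<delta> in simp)
    obtain j :: "real \<Rightarrow> nat" where j: "filterlim j at_top at_top"
      and j1: "eventually (\<lambda>t. t * lam (j t) < \<delta> * ln (real (j t))) at_top"
      and j2: "eventually (\<lambda>t. \<delta> * ln (real (j t - 1)) \<le> t * lam (j t - 1)) at_top"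
      using crossing_level[OF \<delta>(1) ev] by blast
    have jbig: "eventually (\<lambda>t. 1 \<le> ln (real (j t - 1)) \<and> j t \<ge> 3) at_top"
    proof -
      have "filterlim (\<lambda>n::nat. ln (real (n - 1))) at_top sequentially"
        by (rule filterlim_compose[OF ln_top]) (rule filterlim_minus_const_nat_at_top)
      from filterlim_compose[OF this j] have "eventually (\<lambda>t. 1 \<le> ln (real (j t - 1))) at_top"
        by (auto simp: filterlim_at_top)
      moreover have "eventually (\<lambda>t. j t \<ge> 3) at_top" using j by (auto simp: filterlim_at_top)
      ultimately show ?thesis by (rule eventually_conj)
    qed
    have lnj: "eventually (\<lambda>t. 1 \<le> ln (real (j t))) at_top"
      using jbig
    proof eventually_elim
      case (elim t)
      hence "ln (real (j t - 1)) \<le> ln (real (j t))" by (subst ln_le_cancel_iff) auto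
      thus ?case using elim by linarith
    qed
    have lower: "eventually (\<lambda>t. \<delta> \<le> t * lam (j t - 1)) at_top"
      using j2 jbig
    proof eventually_elim
      case (elim t)
      have "\<delta> * 1 \<le> \<delta> * ln (real (j t - 1))" using elim \<delta> by (intro mult_left_mono) auto
      thus ?case using elim by linarith
    qed
    have upper: "eventually (\<lambda>t. t * lam (j t) \<le> (ln (real (j t)))\<^sup>2) at_top"
      using j1 lnj
    proof eventually_elim
      case (elim t)
      have "\<delta> * ln (real (j t)) \<le> ln (real (j t)) * ln (real (j t))"
        using elim \<delta> by (intro mult_right_mono) auto
      thus ?case using elim unfolding power2_eq_square by linarith
    qed
    note Q = normalisation_psi[OF j \<delta>(1) lower upper]
    define r where "r k = (\<delta> * (ln (real (k - 1)) / ln (real k))) powr (1 / \<alpha>) * exp (- (1 / ln (real k))) *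
        (real k / (real k + 1)) * (phi_factor (k - 1) / phi_factor k)" for k :: nat
    have "r \<longlonglongrightarrow> (\<delta> * 1) powr (1 / \<alpha>) * exp (- 0) * 1 * 1"
      unfolding r_def
    proof (intro tendsto_mult tendsto_powr tendsto_const tendsto_exp tendsto_minus phi_factor_ratio)
      show "(\<lambda>k. ln (real (k - 1)) / ln (real k)) \<longlonglongrightarrow> 1"
      proof (rule LIMSEQ_imp_Suc)
        show "(\<lambda>k. ln (real (Suc k - 1)) / ln (real (Suc k))) \<longlonglongrightarrow> 1" unfolding diff_Suc_1 by real_asymp
      qed
      show "(\<lambda>k::nat. 1 / ln (real k)) \<longlonglongrightarrow> 0" by real_asymp
      show "(\<lambda>k::nat. real k / (real k + 1)) \<longlonglongrightarrow> 1" by real_asymp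
    qed (use \<delta> in auto)
    hence r: "r \<longlonglongrightarrow> \<delta> powr (1 / \<alpha>)" by simp
    have "\<delta> powr (1 / \<alpha>) \<le> 1" using \<delta> \<alpha>_pos by (intro powr_le1) auto
    with tendsto_min[OF r tendsto_const[of 1]]
    have "(\<lambda>k. min (r k) 1) \<longlonglongrightarrow> \<delta> powr (1 / \<alpha>)" by (simp add: min_absorb1)
    hence W: "((\<lambda>t. min (r (j t)) 1) \<longlongrightarrow> \<delta> powr (1 / \<alpha>)) at_top" by (rule filterlim_compose[OF _ j])
    have "filterlim (\<lambda>k::nat. (1 / ln (real k)) powr (1 / \<alpha>) * real k powr (1 - \<delta>) / ln (real k) powr (1 / \<alpha>))
            at_top sequentially"
      using \<delta> \<alpha>_pos by real_asymp
    hence "eventually (\<lambda>k::nat. 1 \<le> (1 / ln (real k)) powr (1 / \<alpha>) * real k powr (1 - \<delta>) /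
              ln (real k) powr (1 / \<alpha>)) sequentially"
      by (auto simp: filterlim_at_top)
    note far = eventually_compose_filterlim[OF this j]
    show ?thesis
    proof (rule Liminf_ratio_normalised[OF _ Q _ _ W])
      show "eventually (\<lambda>t. t powr (1 / \<alpha>) > 0 \<and> ln (real (j t)) powr (1 / \<alpha>) * phi_factor (j t) > 0) at_top"
        using eventually_gt_at_top[of 0] jbig
        by eventually_elim (auto intro!: mult_pos_pos phi_factor_pos)
      show "eventually (\<lambda>t. ln (real (j t)) powr (1 / \<alpha>) * phi_factor (j t) * min (r (j t)) 1 \<le>
                           t powr (1 / \<alpha>) * p t) at_top"
        using eventually_gt_at_top[of 0] jbig j1 j2 lnj far
      proof eventually_elim
        case (elim t)
        define k where "k = j t"
        define l where "l = ln (real k)"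
        define S where "S = l powr (1 / \<alpha>)"
        define X where "X = t * lam k"
        define Y where "Y = X powr (1 / \<alpha>)"
        have k: "k \<ge> 3" and t: "t > 0" using elim by (auto simp: k_def)
        have B: "phi_factor k > 0" "phi_factor (k - 1) > 0" using k by (auto intro: phi_factor_pos)
        have l: "l \<ge> 1" using elim by (simp add: l_def k_def)
        have S: "S > 0" using l by (simp add: S_def)
        have X: "X > 0" using t lam_pos[of k] k by (simp add: X_def)
        have Y: "Y > 0" using X by (simp add: Y_def)
        \<comment> \<open>The dividing line \<open>1 / l\<close> tends to 0, as the first case needs, but so slowly that the second
          loses only powers of \<open>l = ln k\<close>.\<close>
        have "S * min (r k) 1 \<le> Y * exp (- X) * real k"
        proof (cases "X \<le> 1 / l")
          case True
          have k2: "k \<ge> 2" using k by simp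
          have "(\<delta> * ln (real (k - 1))) powr (1 / \<alpha>) \<le> (t * lam (k - 1)) powr (1 / \<alpha>)"
            using elim \<delta> \<alpha>_pos by (intro powr_mono2) (auto simp: k_def)
          hence "(\<delta> * ln (real (k - 1))) powr (1 / \<alpha>) * phi_factor (k - 1) \<le> (t * lam (k - 1)) powr (1 / \<alpha>) * phi_factor (k - 1)"
            using B by (intro mult_right_mono) auto
          also have "\<dots> = (real k + 1) * (Y * phi_factor k)"
            using level_shift[OF t k2] by (simp add: Y_def X_def)
          also have "\<dots> = Y * (phi_factor k * (real k + 1))" by simp
          finally have "(\<delta> * ln (real (k - 1))) powr (1 / \<alpha>) * phi_factor (k - 1) / (phi_factor k * (real k + 1)) \<le> Y"
            using B by (subst pos_divide_le_eq) auto
          hence Yl: "(\<delta> * ln (real (k - 1))) powr (1 / \<alpha>) * (phi_factor (k - 1) / phi_factor k) / (real k + 1) \<le> Y"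
            by simp
          have split: "(\<delta> * (ln (real (k - 1)) / l)) powr (1 / \<alpha>) * S = (\<delta> * ln (real (k - 1))) powr (1 / \<alpha>)"
          proof -
            have "(\<delta> * (ln (real (k - 1)) / l)) powr (1 / \<alpha>) * l powr (1 / \<alpha>) =
                  (\<delta> * (ln (real (k - 1)) / l) * l) powr (1 / \<alpha>)"
              by (rule powr_mult[symmetric])
            thus ?thesis using l by (simp add: S_def)
          qed
          have "S * r k = (\<delta> * ln (real (k - 1))) powr (1 / \<alpha>) * (phi_factor (k - 1) / phi_factor k) / (real k + 1) *
                           (exp (- (1 / l)) * real k)"
            unfolding r_def l_def[symmetric] split[symmetric] by (simp add: mult_ac)
          also have "\<dots> \<le> Y * (exp (- X) * real k)"
            using Yl True Y by (intro mult_mono) auto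
          finally have "S * r k \<le> Y * exp (- X) * real k" by (simp add: mult_ac)
          moreover have "S * min (r k) 1 \<le> S * r k" using S by (intro mult_left_mono) auto
          ultimately show ?thesis by linarith
        next
          case False
          have "(1 / l) powr (1 / \<alpha>) \<le> Y"
            unfolding Y_def using False l \<alpha>_pos by (intro powr_mono2) auto
          moreover have "real k powr (1 - \<delta>) \<le> exp (- X) * real k"
          proof -
            have "real k powr (1 - \<delta>) = exp (l - \<delta> * l)"
              using k by (simp add: powr_def l_def algebra_simps)
            also have "\<dots> \<le> exp (l - X)" using elim by (simp add: X_def k_def l_def)
            also have "\<dots> = exp (- X) * real k" using k by (simp add: exp_diff exp_minus l_def divide_inverse)
            finally show ?thesis .
          qed
          ultimately have "(1 / l) powr (1 / \<alpha>) * real k powr (1 - \<delta>) \<le> Y * (exp (- X) * real k)"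
            using Y by (intro mult_mono) auto
          moreover have "S \<le> (1 / l) powr (1 / \<alpha>) * real k powr (1 - \<delta>)"
            using elim S by (simp add: S_def l_def k_def pos_le_divide_eq)
          moreover have "S * min (r k) 1 \<le> S * 1" using S by (intro mult_left_mono) auto
          ultimately show ?thesis by (simp add: mult_ac)
        qed
        hence "S * min (r k) 1 * phi_factor k \<le> Y * exp (- X) * real k * phi_factor k"
          using B by (intro mult_right_mono) auto
        also have "\<dots> \<le> t powr (1 / \<alpha>) * p t"
          unfolding Y_def X_def using t k by (intro diag_kernel_lower) auto
        finally show ?case by (simp add: S_def l_def k_def mult_ac)
      qed
    qed simp
  qed
  have "(\<lambda>n::nat. 1 - 1 / (real n + 2)) \<longlonglongrightarrow> 1" by real_asymp
  hence "(\<lambda>n::nat. (1 - 1 / (real n + 2)) powr (1 / \<alpha>)) \<longlonglongrightarrow> 1 powr (1 / \<alpha>)"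
    by (intro tendsto_powr tendsto_const) auto
  hence "(\<lambda>n::nat. ereal ((1 - 1 / (real n + 2)) powr (1 / \<alpha>))) \<longlonglongrightarrow> 1" by (simp add: one_ereal_def)
  thus ?thesis
  proof (rule tendsto_upperbound)
    show "eventually (\<lambda>n::nat. ereal ((1 - 1 / (real n + 2)) powr (1 / \<alpha>)) \<le>
            Liminf at_top (\<lambda>t. ereal (p t / \<psi> \<alpha> \<phi> t))) sequentially"
      by (intro always_eventually allI bound) (auto simp: field_simps)
  qed simp
qed

end

theorem theorem5p1:
  fixes \<alpha> \<kappa> :: real and \<phi> :: "real \<Rightarrow> real" and x :: "nat perm"
  assumes "\<alpha> > 0"
    and "\<And>s. s \<ge> ln 2 \<Longrightarrow> \<phi> s > 0"
    and "smoothly_varying \<phi> \<kappa>"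
    and "strict_antimono_on {2..} (Lambda \<alpha> \<phi>)"
  shows "Limsup at_top (\<lambda>t::real. ereal (heat_kernel (Lambda \<alpha> \<phi>) t x x / \<Psi> \<alpha> \<phi> t)) = 1 \<and>
         Liminf at_top (\<lambda>t::real. ereal (heat_kernel (Lambda \<alpha> \<phi>) t x x / \<psi> \<alpha> \<phi> t)) = 1 \<and>
         limsup (\<lambda>n::nat. ereal (heat_kernel (Lambda \<alpha> \<phi>) (real n) x x / \<Psi> \<alpha> \<phi> (real n))) = 1 \<and>
         liminf (\<lambda>n::nat. ereal (heat_kernel (Lambda \<alpha> \<phi>) (real n) x x / \<psi> \<alpha> \<phi> (real n))) = 1 \<and>
         limsup (\<lambda>n::nat. ereal (return_prob (Lambda \<alpha> \<phi>) n / \<Psi> \<alpha> \<phi> (real n))) = 1 \<and>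
         liminf (\<lambda>n::nat. ereal (return_prob (Lambda \<alpha> \<phi>) n / \<psi> \<alpha> \<phi> (real n))) = 1"
proof -
  interpret symmetric_group_spectrum \<phi> \<kappa> \<alpha>
    by standard (use assms in auto)
  have "limsup (\<lambda>n. ereal (p (real n) / \<Psi> \<alpha> \<phi> (real n))) \<le> Limsup at_top (\<lambda>t. ereal (p t / \<Psi> \<alpha> \<phi> t))"
    by (rule Limsup_compose_le[OF filterlim_real_sequentially])
  moreover have "Liminf at_top (\<lambda>t. ereal (p t / \<psi> \<alpha> \<phi> t)) \<le> liminf (\<lambda>n. ereal (p (real n) / \<psi> \<alpha> \<phi> (real n)))"
    by (rule Liminf_compose_ge[OF filterlim_real_sequentially])
  ultimately show ?thesis
    unfolding heat_kernel_diagonal return_prob_eq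
    using Limsup_le_1 limsup_ge_1 liminf_le_1 Liminf_ge_1 by (auto intro: antisym order_trans)
qed

end
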